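(* Let $d\geq2$ and let $\phi:\mathbb{R}^d\to\mathbb{R}$ be a nonnegative, continuously differentiable, strictly convex function. Let $\varphi=|\cdot|^2$ and $\psi=|\cdot|^2+\phi$. Let $\sigma_0,\sigma$ denote the projection measures on the hypersurfaces $\Sigma_0=\{(y,\varphi(y)):y\in\mathbb{R}^d\}$ and $\Sigma_\phi=\{(y,\psi(y)):y\in\mathbb{R}^d\}$, respectively. Then $$(\sigma\ast\sigma)(\xi,2\psi(\xi/2)+\tau)\leq(\sigma_0\ast\sigma_0)(\xi,2\varphi(\xi/2)+\tau)$$ for every $\xi\in\mathbb{R}^d$ and $\tau>0$. Moreover, this inequality is strict for almost every point in the support of the measure $\sigma\ast\sigma$ (i.e. for almost every point $(\xi,2\psi(\xi/2)+\tau)$ of that support).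
   Context: The projection measure on the graph of $\Psi:\mathbb{R}^d\to\mathbb{R}$ is the measure on $\mathbb{R}^{d+1}$ given by $\int g\,d\sigma=\int_{\mathbb{R}^d}g(y,\Psi(y))\,dy$ for every Schwartz function $g$. The convolution of this measure with itself is identified with its density with respect to Lebesgue measure, whose pointwise values are $$(\sigma\ast\sigma)(\xi,\tau)=\int_{\mathbb{R}^d}\delta\big(\tau-\Psi(\xi/2-y)-\Psi(\xi/2+y)\big)\,dy.$$ Here, for $\tau>2\Psi(\xi/2)$, the delta integral is the integral of $1/|\nabla F|$ with respect to $(d-1)$-dimensional surface measure on the level set $\{y: F(y)=\tau\}$, with $F(y)=\Psi(\xi/2-y)+\Psi(\xi/2+y)$ (for $\Psi$ continuously differentiable and strictly convex, $\tau$ is a regular value of $F$). The support of $\sigma\ast\sigma$ is $\{(\xi,\tau):\tau\geq2\psi(\xi/2)\}$. *)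

theory Defs
  imports "HOL-Analysis.Analysis" "HOL-Probability.Probability"
begin

definition strictly_convex_on :: "'a::real_vector set \<Rightarrow> ('a \<Rightarrow> real) \<Rightarrow> bool" where
  "strictly_convex_on S f \<longleftrightarrow> convex S \<and>
    (\<forall>x\<in>S. \<forall>y\<in>S. \<forall>u>0. \<forall>v>0. x \<noteq> y \<and> u + v = 1
      \<longrightarrow> f (u *\<^sub>R x + v *\<^sub>R y) < u * f x + v * f y)"

(* Meaningful only where f is differentiable; there the vector is unique. *)
definition gradient :: "('a::euclidean_space \<Rightarrow> real) \<Rightarrow> 'a \<Rightarrow> 'a" where
  "gradient f x = (THE D. GDERIV f x :> D)"


text \<open>
  Surface measure of dimension \<open>k\<close> is the \<open>k\<close>-dimensional Hausdorff measure, with the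
  normalisation that makes it agree with Lebesgue measure in dimension \<open>k\<close>.
  Covers are restricted to bounded sets because the library's diameter is unspecified on
  unbounded ones. The separate value for the empty set matters only for \<open>k = 0\<close>.
\<close>

definition hausdorff_weight :: "nat \<Rightarrow> 'a::euclidean_space set \<Rightarrow> ennreal" where
  "hausdorff_weight k C =
    (if C = {} then 0 else ennreal (unit_ball_vol (real k) * (diameter C / 2) ^ k))"

definition hausdorff_premeasure :: "nat \<Rightarrow> real \<Rightarrow> 'a::euclidean_space set \<Rightarrow> ennreal" where
  "hausdorff_premeasure k \<delta> A =
    (INF C \<in> {C :: nat \<Rightarrow> 'a set. A \<subseteq> (\<Union>i. C i) \<and> (\<forall>i. bounded (C i) \<and> diameter (C i) \<le> \<delta>)}.
      \<Sum>i. hausdorff_weight k (C i))"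

definition hausdorff_outer_measure :: "nat \<Rightarrow> 'a::euclidean_space set \<Rightarrow> ennreal" where
  "hausdorff_outer_measure k A = (SUP \<delta> \<in> {0<..}. hausdorff_premeasure k \<delta> A)"

definition hausdorff_measure :: "nat \<Rightarrow> 'a::euclidean_space measure" where
  "hausdorff_measure k = measure_of UNIV (sets borel) (hausdorff_outer_measure k)"


definition projection_measure ::
    "('a::euclidean_space \<Rightarrow> real) \<Rightarrow> ('a \<times> real) measure" where
  "projection_measure \<Psi> = distr lborel borel (\<lambda>y. (y, \<Psi> y))"

(* The integral of delta(tau - F(y)) dy, for tau a regular value of F. *)
definition delta_integral :: "('a::euclidean_space \<Rightarrow> real) \<Rightarrow> real \<Rightarrow> ennreal" where
  "delta_integral F \<tau> =
    (\<integral>\<^sup>+ y \<in> {y. F y = \<tau>}. ennreal (1 / norm (gradient F y))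
      \<partial>hausdorff_measure (DIM('a) - 1))"

(* Pointwise density of projection_measure Psi convolved with itself, at points
   (xi, tau) with tau > 2 Psi(xi/2); elsewhere the value carries no meaning. *)
definition convolution_density ::
    "('a::euclidean_space \<Rightarrow> real) \<Rightarrow> 'a \<Rightarrow> real \<Rightarrow> ennreal" where
  "convolution_density \<Psi> \<xi> \<tau> =
    delta_integral (\<lambda>y. \<Psi> (\<xi> /\<^sub>R 2 - y) + \<Psi> (\<xi> /\<^sub>R 2 + y)) \<tau>"

definition measure_support :: "'a::topological_space measure \<Rightarrow> 'a set" where
  "measure_support M = {x. \<forall>U. open U \<and> x \<in> U \<longrightarrow> emeasure M U \<noteq> 0}"

end

theory Submission
  imports Defs
begin

text \<open>
  For \<open>c = \<xi>/2\<close> the level set \<open>L\<close> defining \<open>(\<sigma> \<star> \<sigma>)(\<xi>, 2\<psi>(c) + \<tau>)\<close> is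
  \<open>{y. 2|y|\<^sup>2 + \<Phi>(y) - \<Phi>(0) = \<tau>}\<close> with \<open>\<Phi>(y) = \<phi>(c - y) + \<phi>(c + y)\<close> even and strictly convex, and
  for the paraboloid it is the sphere of radius \<open>r = \<surd>(\<tau>/2)\<close>. In polar coordinates \<open>y = R(\<omega>)\<omega>\<close> the
  delta integral is \<open>\<integral> R^(d-1) / (4R + \<partial>\<^sub>r\<Phi>) d\<omega>\<close>; since \<open>R \<le> r\<close> and \<open>\<partial>\<^sub>r\<Phi> > 0\<close>, the integrand is below the
  value \<open>r^(d-2) / 4\<close> for the sphere. So the inequality is strict for every \<open>\<tau> > 0\<close>, and the rest of
  the support lies on the graph of \<open>2\<psi>(\<xi>/2)\<close>, a null set.

  Only an upper bound for Hausdorff measure on \<open>L\<close> is needed, which avoids the area formula: near each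
  point, \<open>L\<close> is a nearly 1-Lipschitz image of a dilated linear stretching of the orthogonal projection of
  its radial image on the sphere. Orthogonal projection does not increase Hausdorff measure,
  and linear maps scale it as they scale Lebesgue measure, because both are translation invariant.
\<close>

section \<open>Hausdorff measure\<close>

lemma hausdorff_weight_empty [simp]: "hausdorff_weight k {} = 0"
  by (simp add: hausdorff_weight_def)

lemma hausdorff_premeasure_le:
  assumes "A \<subseteq> (\<Union>i. C i)" "\<And>i. bounded (C i)" "\<And>i. diameter (C i) \<le> \<delta>"
  shows "hausdorff_premeasure k \<delta> A \<le> (\<Sum>i. hausdorff_weight k (C i))"
  unfolding hausdorff_premeasure_def using assms by (intro INF_lower) auto

lemma le_hausdorff_premeasure:
  assumes "\<And>C. A \<subseteq> (\<Union>i. C i) \<Longrightarrow> (\<And>i. bounded (C i)) \<Longrightarrow> (\<And>i. diameter (C i) \<le> \<delta>)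
    \<Longrightarrow> x \<le> (\<Sum>i. hausdorff_weight k (C i))"
  shows "x \<le> hausdorff_premeasure k \<delta> A"
  unfolding hausdorff_premeasure_def using assms by (intro INF_greatest) auto

lemma hausdorff_premeasure_cover:
  assumes "hausdorff_premeasure k \<delta> A < x"
  obtains C where "A \<subseteq> (\<Union>i. C i)" "\<And>i. bounded (C i)" "\<And>i. diameter (C i) \<le> \<delta>"
    "(\<Sum>i. hausdorff_weight k (C i)) < x"
  using assms unfolding hausdorff_premeasure_def INF_less_iff by auto

lemma hausdorff_premeasure_mono:
  assumes "A \<subseteq> B"
  shows "hausdorff_premeasure k \<delta> A \<le> hausdorff_premeasure k \<delta> B"
  using assms by (intro le_hausdorff_premeasure hausdorff_premeasure_le) auto

lemma hausdorff_premeasure_antimono: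
  assumes "\<delta> \<le> \<delta>'"
  shows "hausdorff_premeasure k \<delta>' A \<le> hausdorff_premeasure k \<delta> A"
  by (meson assms hausdorff_premeasure_le le_hausdorff_premeasure order_trans)

lemma hausdorff_premeasure_finite_cover:
  assumes "finite I" "A \<subseteq> (\<Union>i\<in>I. C i)" "\<And>i. i \<in> I \<Longrightarrow> bounded (C i)"
    "\<And>i. i \<in> I \<Longrightarrow> diameter (C i) \<le> \<delta>" "0 \<le> \<delta>"
  shows "hausdorff_premeasure k \<delta> A \<le> (\<Sum>i\<in>I. hausdorff_weight k (C i))"
proof -
  obtain f where f: "bij_betw f {..<card I} I"
    using assms(1) ex_bij_betw_nat_finite lessThan_atLeast0 by metis
  \<comment> \<open>The finite family is padded with empty sets, whose weight is 0 even for
    \<open>k = 0\<close>.\<close>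
  define B where "B i = (if i < card I then C (f i) else {})" for i
  have fI: "f i \<in> I" if "i < card I" for i
    using f that by (auto simp: bij_betw_def)
  have "x \<in> (\<Union>i. B i)" if xA: "x \<in> A" for x
  proof -
    obtain j where j: "j \<in> I" "x \<in> C j" using assms(2) xA by blast
    then obtain i where "i < card I" "f i = j"
      using f unfolding bij_betw_def by (metis imageE lessThan_iff)
    with j show ?thesis by (auto simp: B_def intro!: exI[of _ i])
  qed
  then have "hausdorff_premeasure k \<delta> A \<le> (\<Sum>i. hausdorff_weight k (B i))"
    using assms(3-5) fI by (intro hausdorff_premeasure_le) (auto simp: B_def)
  also have "\<dots> = (\<Sum>i<card I. hausdorff_weight k (B i))"
    by (rule suminf_finite) (auto simp: B_def)
  also have "\<dots> = (\<Sum>i\<in>I. hausdorff_weight k (C i))"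
    using sum.reindex_bij_betw[OF f, of "\<lambda>i. hausdorff_weight k (C i)"] by (simp add: B_def)
  finally show ?thesis .
qed

text \<open>Each \<open>A n\<close> gets a cover whose total weight exceeds the infimum by at most
  \<open>e / 2^(n+1)\<close>. \<open>prod_decode\<close> lists all these covers as one sequence, and
  the errors sum to \<open>e\<close>.\<close>

lemma hausdorff_premeasure_UN:
  assumes "0 \<le> \<delta>"
  shows "hausdorff_premeasure k \<delta> (\<Union>i. A i) \<le> (\<Sum>i. hausdorff_premeasure k \<delta> (A i))"
proof (rule ennreal_le_epsilon)
  fix e :: real
  let ?O = "\<lambda>A. hausdorff_premeasure k \<delta> A"
  assume "0 < e" "(\<Sum>n. ?O (A n)) < top"
  then have *: "?O (A n) < ?O (A n) + e * (1/2)^Suc n" for n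
    by (auto simp add: less_top dest!: ennreal_suminf_lessD)
  have "\<exists>B. A n \<subseteq> (\<Union>i. B i) \<and> (\<forall>i. bounded (B i)) \<and> (\<forall>i. diameter (B i) \<le> \<delta>) \<and>
    (\<Sum>i. hausdorff_weight k (B i)) \<le> ?O (A n) + e * (1/2)^(Suc n)" for n
    using hausdorff_premeasure_cover[OF *] by (metis less_imp_le)
  then obtain B where B: "\<And>n. A n \<subseteq> (\<Union>i. B n i)" "\<And>n i. bounded (B n i)"
    "\<And>n i. diameter (B n i) \<le> \<delta>"
    "\<And>n. (\<Sum>i. hausdorff_weight k (B n i)) \<le> ?O (A n) + e * (1/2)^(Suc n)"
    by metis
  define C where "C = case_prod B o prod_decode"
  have A_C: "(\<Union>i. A i) \<subseteq> (\<Union>i. C i)"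
    using B(1) by (auto simp add: C_def subset_eq) (metis prod.case prod_encode_inverse)
  have "?O (\<Union>i. A i) \<le> (\<Sum>i. hausdorff_weight k (C i))"
    using B A_C by (intro hausdorff_premeasure_le) (auto simp: C_def split: prod.splits)
  also have "\<dots> = (\<Sum>n. \<Sum>i. hausdorff_weight k (B n i))"
    unfolding C_def comp_def
    using suminf_ennreal_2dimen[where f="\<lambda>p. hausdorff_weight k (case_prod B p)"] by auto
  also have "\<dots> \<le> (\<Sum>n. ?O (A n) + e * (1/2) ^ Suc n)"
    by (intro suminf_le B) auto
  also have "... = (\<Sum>n. ?O (A n)) + (\<Sum>n. ennreal e * ennreal ((1/2) ^ Suc n))"
    using \<open>0 < e\<close> by (subst suminf_add[symmetric])
                     (auto simp del: ennreal_suminf_cmult simp add: ennreal_mult[symmetric])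
  also have "\<dots> = (\<Sum>n. ?O (A n)) + e"
    unfolding ennreal_suminf_cmult
    by (subst suminf_ennreal_eq[OF zero_le_power power_half_series]) auto
  finally show "?O (\<Union>i. A i) \<le> (\<Sum>n. ?O (A n)) + e" .
qed

section \<open>The outer measure as a limit of scales\<close>

lemma hausdorff_premeasure_le_outer:
  "0 < \<delta> \<Longrightarrow> hausdorff_premeasure k \<delta> A \<le> hausdorff_outer_measure k A"
  unfolding hausdorff_outer_measure_def by (intro SUP_upper) auto

lemma hausdorff_outer_measure_le:
  assumes "\<And>\<delta>. 0 < \<delta> \<Longrightarrow> hausdorff_premeasure k \<delta> A \<le> x"
  shows "hausdorff_outer_measure k A \<le> x"
  unfolding hausdorff_outer_measure_def using assms by (intro SUP_least) auto

lemma hausdorff_outer_measure_mono: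
  "A \<subseteq> B \<Longrightarrow> hausdorff_outer_measure k A \<le> hausdorff_outer_measure k B"
  by (meson hausdorff_outer_measure_le hausdorff_premeasure_le_outer hausdorff_premeasure_mono order_trans)

lemma hausdorff_outer_measure_empty [simp]:
  "hausdorff_outer_measure k ({} :: 'a::euclidean_space set) = 0"
proof -
  have "hausdorff_premeasure k \<delta> ({} :: 'a set) \<le> 0" if "0 < \<delta>" for \<delta>
    using hausdorff_premeasure_finite_cover[of "{} :: nat set" "{} :: 'a set" "\<lambda>_. {}" \<delta> k] that by simp
  then show ?thesis using hausdorff_outer_measure_le[of k "{} :: 'a set" 0] by simp
qed

lemma hausdorff_outer_measure_UN:
  "hausdorff_outer_measure k (\<Union>i. A i) \<le> (\<Sum>i. hausdorff_outer_measure k (A i))"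
proof (rule hausdorff_outer_measure_le)
  fix \<delta> :: real assume "0 < \<delta>"
  then have "hausdorff_premeasure k \<delta> (\<Union>i. A i) \<le> (\<Sum>i. hausdorff_premeasure k \<delta> (A i))"
    by (intro hausdorff_premeasure_UN) simp
  also have "\<dots> \<le> (\<Sum>i. hausdorff_outer_measure k (A i))"
    using \<open>0 < \<delta>\<close> by (intro suminf_le hausdorff_premeasure_le_outer) auto
  finally show "hausdorff_premeasure k \<delta> (\<Union>i. A i) \<le> (\<Sum>i. hausdorff_outer_measure k (A i))" .
qed

lemma outer_measure_space_hausdorff:
  "outer_measure_space UNIV (hausdorff_outer_measure k)"
  unfolding outer_measure_space_def positive_def increasing_def countably_subadditive_def
  by (auto intro: hausdorff_outer_measure_mono hausdorff_outer_measure_UN)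

section \<open>Caratheodory measurability of Borel sets\<close>

lemma hausdorff_outer_measure_Un:
  "hausdorff_outer_measure k (A \<union> B) \<le> hausdorff_outer_measure k A + hausdorff_outer_measure k B"
proof -
  have "hausdorff_outer_measure k (\<Union>i. binaryset A B i) \<le> (\<Sum>i. hausdorff_outer_measure k (binaryset A B i))"
    by (rule hausdorff_outer_measure_UN)
  then show ?thesis
    by (simp add: UN_binaryset_eq suminf_binaryset_eq)
qed

text \<open>At scales below \<open>d\<close> no covering set meets both \<open>A\<close> and
  \<open>B\<close>, so a cover of the union splits into a cover of \<open>A\<close> and one of
  \<open>B\<close> that share no weight. This is the metric property from which additivity on Borel
  sets follows.\<close>

lemma hausdorff_outer_measure_separated:
  fixes A B :: "'a::euclidean_space set"
  assumes d: "0 < d" "\<And>x y. x \<in> A \<Longrightarrow> y \<in> B \<Longrightarrow> d \<le> dist x y"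
  shows "hausdorff_outer_measure k A + hausdorff_outer_measure k B \<le> hausdorff_outer_measure k (A \<union> B)"
proof -
  have pre: "hausdorff_premeasure k \<delta> A + hausdorff_premeasure k \<delta> B \<le> hausdorff_premeasure k \<delta> (A \<union> B)"
    if \<delta>: "0 < \<delta>" "\<delta> < d" for \<delta>
  proof (rule le_hausdorff_premeasure)
    fix C :: "nat \<Rightarrow> 'a set" assume C: "A \<union> B \<subseteq> (\<Union>i. C i)" "\<And>i. bounded (C i)" "\<And>i. diameter (C i) \<le> \<delta>"
    define CA where "CA i = (if C i \<inter> A = {} then {} else C i)" for i :: nat
    define CB where "CB i = (if C i \<inter> B = {} then {} else C i)" for i :: nat
    have "hausdorff_premeasure k \<delta> A \<le> (\<Sum>i. hausdorff_weight k (CA i))"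
      using C \<delta> by (intro hausdorff_premeasure_le) (auto simp: CA_def, blast)
    moreover have "hausdorff_premeasure k \<delta> B \<le> (\<Sum>i. hausdorff_weight k (CB i))"
      using C \<delta> by (intro hausdorff_premeasure_le) (auto simp: CB_def, blast)
    ultimately have "hausdorff_premeasure k \<delta> A + hausdorff_premeasure k \<delta> B
        \<le> (\<Sum>i. hausdorff_weight k (CA i)) + (\<Sum>i. hausdorff_weight k (CB i))"
      by (rule add_mono)
    also have "\<dots> = (\<Sum>i. hausdorff_weight k (CA i) + hausdorff_weight k (CB i))"
      by (rule suminf_add) auto
    also have "\<dots> \<le> (\<Sum>i. hausdorff_weight k (C i))"
    proof (intro suminf_le)
      fix i
      have "C i \<inter> A = {} \<or> C i \<inter> B = {}"
      proof (rule ccontr)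
        assume "\<not> ?thesis"
        then obtain x y where xy: "x \<in> C i" "x \<in> A" "y \<in> C i" "y \<in> B" by auto
        have "dist x y \<le> diameter (C i)"
          using xy C(2) by (intro diameter_bounded_bound) auto
        with C(3)[of i] d(2)[OF xy(2,4)] \<delta> show False by linarith
      qed
      then show "hausdorff_weight k (CA i) + hausdorff_weight k (CB i) \<le> hausdorff_weight k (C i)"
        by (auto simp: CA_def CB_def)
    qed auto
    finally show "hausdorff_premeasure k \<delta> A + hausdorff_premeasure k \<delta> B
      \<le> (\<Sum>i. hausdorff_weight k (C i))" .
  qed
  let ?P = "\<lambda>\<delta> A. hausdorff_premeasure k \<delta> A"
  \<comment> \<open>The premeasure grows as the scale shrinks, so both suprema can be taken along a
    common scale.\<close>
  have "hausdorff_outer_measure k A + hausdorff_outer_measure k B = (SUP \<delta>\<in>{0<..}. ?P \<delta> A + ?P \<delta> B)"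
    unfolding hausdorff_outer_measure_def
  proof (rule SUP_add_directed_ennreal[symmetric])
    fix i j :: real assume "i \<in> {0<..}" "j \<in> {0<..}"
    then show "\<exists>l\<in>{0<..}. ?P i A + ?P j B \<le> ?P l A + ?P l B"
      by (intro bexI[of _ "min i j"] add_mono hausdorff_premeasure_antimono) auto
  qed
  also have "\<dots> \<le> hausdorff_outer_measure k (A \<union> B)"
  proof (rule SUP_least)
    fix \<delta> :: real assume "\<delta> \<in> {0<..}"
    then have "?P \<delta> A + ?P \<delta> B \<le> ?P (min \<delta> (d/2)) A + ?P (min \<delta> (d/2)) B"
      by (intro add_mono hausdorff_premeasure_antimono) auto
    also have "\<dots> \<le> ?P (min \<delta> (d/2)) (A \<union> B)"
      using \<open>\<delta> \<in> {0<..}\<close> d(1) by (intro pre) auto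
    also have "\<dots> \<le> hausdorff_outer_measure k (A \<union> B)"
      using \<open>\<delta> \<in> {0<..}\<close> d(1) by (intro hausdorff_premeasure_le_outer) auto
    finally show "?P \<delta> A + ?P \<delta> B \<le> hausdorff_outer_measure k (A \<union> B)" .
  qed
  finally show ?thesis .
qed

text \<open>Caratheodory's criterion for metric outer measures. The part of \<open>T\<close> outside
  \<open>F\<close> splits into \<open>Tn n\<close>, at positive distance from \<open>F\<close>, and
  the shells \<open>R i\<close> with i \<ge> n, where the distance to \<open>F\<close> lies between
  1/(i+2) and 1/(i+1). If \<open>T\<close> has finite measure, the measures of the shells have a
  finite sum, so the tail is negligible.\<close>

lemma closed_in_hausdorff_lambda_system:
  assumes "closed F"
  shows "F \<in> lambda_system UNIV UNIV (hausdorff_outer_measure k)"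
proof (cases "F = {}")
  case True
  then show ?thesis by (simp add: lambda_system_def)
next
  case F: False
  let ?H = "hausdorff_outer_measure k"
  have "?H (F \<inter> T) + ?H ((UNIV - F) \<inter> T) \<le> ?H T" for T
  proof (cases "?H T = top")
    case False
    define Tn where "Tn n = {x\<in>T. 1 / real (Suc n) \<le> infdist x F}" for n
    define R where "R n = {x\<in>T. 1 / real (Suc (Suc n)) \<le> infdist x F \<and> infdist x F < 1 / real (Suc n)}" for n
    have T_diff: "(UNIV - F) \<inter> T = Tn n \<union> (\<Union>i. R (i + n))" for n
    proof (intro equalityI subsetI)
      fix x assume x: "x \<in> (UNIV - F) \<inter> T"
      then have pos: "0 < infdist x F"
        using F assms in_closed_iff_infdist_zero[of F x] infdist_nonneg[of x F] by fastforce
      then obtain m where m: "1 / real (Suc m) \<le> infdist x F"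
        using nat_approx_posE less_imp_le by metis
      define l where "l = (LEAST m. 1 / real (Suc m) \<le> infdist x F)"
      have l: "1 / real (Suc l) \<le> infdist x F" "\<And>j. j < l \<Longrightarrow> infdist x F < 1 / real (Suc j)"
        unfolding l_def using LeastI[of "\<lambda>m. 1 / real (Suc m) \<le> infdist x F", OF m]
          not_less_Least[of _ "\<lambda>m. 1 / real (Suc m) \<le> infdist x F"] not_le by auto
      show "x \<in> Tn n \<union> (\<Union>i. R (i + n))"
      proof (cases "l \<le> n")
        case True
        then have "1 / real (Suc n) \<le> 1 / real (Suc l)" by (simp add: frac_le)
        with l x show ?thesis by (auto simp: Tn_def)
      next
        case False
        then have "x \<in> R ((l - Suc n) + n)"
          using l(1) l(2)[of "l - 1"] x by (auto simp: R_def)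
        then show ?thesis by blast
      qed
    next
      fix x assume "x \<in> Tn n \<union> (\<Union>i. R (i + n))"
      then have "x \<in> T" "\<exists>m. 1 / real (Suc m) \<le> infdist x F"
        by (auto simp: Tn_def R_def simp del: of_nat_Suc)
      then have "x \<in> T" "0 < infdist x F"
        by (auto intro: less_le_trans[of 0 "1 / real (Suc _)"])
      then show "x \<in> (UNIV - F) \<inter> T" by (auto simp: infdist_zero)
    qed
    \<comment> \<open>Shells of the same parity are separated by the shell between them, so their
      measures add up. Adjacent shells may touch, hence the split into even and odd indices and the
      bound \<open>?H T + ?H T\<close> below.\<close>
    have sep: "?H (\<Union>i<n. R (2*i+j)) = (\<Sum>i<n. ?H (R (2*i+j)))" for n j
    proof (induction n)
      case (Suc n)
      have "?H (\<Union>i<Suc n. R (2*i+j)) = ?H ((\<Union>i<n. R (2*i+j)) \<union> R (2*n+j))"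
        by (simp add: lessThan_Suc Un_commute)
      also have "\<dots> = ?H (\<Union>i<n. R (2*i+j)) + ?H (R (2*n+j))"
      proof (rule antisym[OF hausdorff_outer_measure_Un])
        \<comment> \<open>For \<open>n = 0\<close> the union is empty and any positive distance
          serves. Otherwise the earlier shells keep distance at least 1/(2n+j) from
          \<open>F\<close>, while every point of \<open>R (2*n+j)\<close> is closer than
          1/(2n+j+1).\<close>
        define d where "d = (if n = 0 then 1 else 1 / real (2*n+j) - 1 / real (Suc (2*n+j)))"
        have "0 < d"
          by (auto simp: d_def intro!: divide_strict_left_mono)
        moreover have "d \<le> dist x y" if xy: "x \<in> (\<Union>i<n. R (2*i+j))" "y \<in> R (2*n+j)" for x y
        proof -
          obtain i where i: "i < n" "x \<in> R (2*i+j)" using xy(1) by auto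
          have "1 / real (2*n+j) \<le> 1 / real (Suc (Suc (2*i+j)))"
            using i(1) by (intro divide_left_mono) auto
          then have "1 / real (2*n+j) \<le> infdist x F"
            using i(2) by (auto simp: R_def)
          moreover have "infdist y F < 1 / real (Suc (2*n+j))"
            using xy(2) by (auto simp: R_def)
          ultimately show ?thesis
            using infdist_triangle[of x F y] i(1) by (auto simp: d_def)
        qed
        ultimately show "?H (\<Union>i<n. R (2*i+j)) + ?H (R (2*n+j)) \<le> ?H ((\<Union>i<n. R (2*i+j)) \<union> R (2*n+j))"
          by (rule hausdorff_outer_measure_separated)
      qed
      finally show ?case using Suc by simp
    qed simp
    have R_sub: "R i \<subseteq> T" for i by (auto simp: R_def)
    have sums_le: "(\<Sum>i<n. ?H (R (2*i+j))) \<le> ?H T" for n j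
      unfolding sep[symmetric] using R_sub by (intro hausdorff_outer_measure_mono) blast
    have sum_le: "(\<Sum>i<n. ?H (R i)) \<le> ?H T + ?H T" for n
    proof -
      have "(\<Sum>i<n. ?H (R i)) \<le> (\<Sum>i<2*n. ?H (R i))"
        by (intro sum_mono2) auto
      also have "\<dots> = (\<Sum>i<n. ?H (R (2*i+0))) + (\<Sum>i<n. ?H (R (2*i+1)))"
        by (induction n) (auto simp: ac_simps)
      also have "\<dots> \<le> ?H T + ?H T"
        by (intro add_mono sums_le)
      finally show ?thesis .
    qed
    have fin_R: "?H (R i) \<noteq> top" for i
      using hausdorff_outer_measure_mono[OF R_sub, of k i] False
      by (auto simp: top_unique)
    define r where "r i = enn2real (?H (R i))" for i
    have r: "?H (R i) = ennreal (r i)" "0 \<le> r i" for i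
      using fin_R[of i] by (auto simp: r_def less_top)
    have "summable r"
    proof (rule summableI_nonneg_bounded)
      fix n
      have "ennreal (\<Sum>i<n. r i) \<le> ?H T + ?H T"
        using sum_le[of n] r by (simp add: sum_ennreal)
      also have "\<dots> = ennreal (enn2real (?H T + ?H T))"
        using False by (simp add: less_top[symmetric])
      finally show "(\<Sum>i<n. r i) \<le> enn2real (?H T + ?H T)"
        by (simp add: ennreal_le_iff)
    qed (use r in auto)
    show ?thesis
    proof (rule ennreal_le_epsilon)
      fix e :: real assume "0 < e"
      obtain n where n: "norm (\<Sum>i. r (i + n)) < e"
        using suminf_exist_split[OF \<open>0 < e\<close> \<open>summable r\<close>] by blast
      have "?H (\<Union>i. R (i + n)) \<le> (\<Sum>i. ?H (R (i + n)))"
        by (rule hausdorff_outer_measure_UN)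
      also have "\<dots> = ennreal (\<Sum>i. r (i + n))"
        using r \<open>summable r\<close> by (simp add: suminf_ennreal2 summable_iff_shift)
      also have "\<dots> \<le> ennreal e"
        using n by (intro ennreal_leI) auto
      finally have tail: "?H (\<Union>i. R (i + n)) \<le> ennreal e" .
      have "?H (F \<inter> T) + ?H ((UNIV - F) \<inter> T) \<le> ?H (F \<inter> T) + (?H (Tn n) + ?H (\<Union>i. R (i + n)))"
        unfolding T_diff[of n] by (intro add_mono hausdorff_outer_measure_Un order_refl)
      also have "\<dots> \<le> (?H (F \<inter> T) + ?H (Tn n)) + e"
        using tail by (simp add: add.assoc add_left_mono)
      also have "?H (F \<inter> T) + ?H (Tn n) \<le> ?H (F \<inter> T \<union> Tn n)"
      proof (rule hausdorff_outer_measure_separated)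
        fix x y assume "x \<in> F \<inter> T" "y \<in> Tn n"
        then show "1 / real (Suc n) \<le> dist x y"
          using infdist_le[of x F y] by (auto simp: Tn_def dist_commute)
      qed simp
      also have "\<dots> \<le> ?H T"
        by (intro hausdorff_outer_measure_mono) (auto simp: Tn_def)
      finally show "?H (F \<inter> T) + ?H ((UNIV - F) \<inter> T) \<le> ?H T + e"
        by (simp add: add_right_mono)
    qed
  qed simp
  moreover have "?H T \<le> ?H (F \<inter> T) + ?H ((UNIV - F) \<inter> T)" for T
  proof -
    have "T = (F \<inter> T) \<union> ((UNIV - F) \<inter> T)" by auto
    then show ?thesis using hausdorff_outer_measure_Un by metis
  qed
  ultimately show ?thesis
    by (auto simp: lambda_system_def intro!: antisym)
qed

lemma sets_hausdorff_measure [simp, measurable_cong]: "sets (hausdorff_measure k) = sets borel"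
  using sets.sigma_sets_eq[of borel] by (simp add: hausdorff_measure_def)

lemma space_hausdorff_measure [simp]: "space (hausdorff_measure k) = UNIV"
  by (simp add: hausdorff_measure_def)

text \<open>\<open>measure_of\<close> returns the prescribed values only if they form a measure on
  the given sets. Caratheodory's theorem supplies this on \<open>?L\<close>, which contains the
  closed sets and therefore all Borel sets.\<close>

lemma emeasure_hausdorff_measure:
  fixes A :: "'a::euclidean_space set"
  assumes "A \<in> sets borel"
  shows "emeasure (hausdorff_measure k) A = hausdorff_outer_measure k A"
proof -
  let ?H = "hausdorff_outer_measure k :: 'a set \<Rightarrow> ennreal"
  let ?L = "lambda_system UNIV UNIV ?H"
  interpret U: sigma_algebra "UNIV :: 'a set" UNIV
    using sigma_algebra_Pow[of UNIV] by simp
  have L: "measure_space UNIV ?L ?H"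
    by (rule U.caratheodory_lemma[OF outer_measure_space_hausdorff])
  then interpret L: sigma_algebra UNIV ?L
    by (simp add: measure_space_def)
  have "sigma_sets UNIV (Collect closed) \<subseteq> ?L"
    by (intro L.sigma_sets_subset) (auto intro: closed_in_hausdorff_lambda_system)
  then have sub: "sets (borel :: 'a measure) \<subseteq> ?L"
    by (simp add: borel_eq_closed)
  have "measure_space UNIV (sets borel) ?H"
    using L sub by (rule_tac measure_down) (auto intro: sets.sigma_algebra_axioms[of borel, simplified])
  then show ?thesis
    using assms sets_hausdorff_measure[of k, where 'a='a]
    by (intro emeasure_measure_of[OF hausdorff_measure_def]) (auto simp: measure_space_def)
qed

text \<open>A cover of \<open>A\<close> at scale \<open>\<delta> / L\<close> is carried to a cover
  of the image at scale \<open>\<delta>\<close>, with diameters multiplied by at most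
  \<open>L\<close>. The covering sets are first cut down to \<open>A\<close>, since \<open>f\<close>
  is controlled only there.\<close>

lemma hausdorff_outer_measure_lipschitz:
  fixes f :: "'a::euclidean_space \<Rightarrow> 'b::euclidean_space"
  assumes L: "0 < L" "\<And>x y. x \<in> A \<Longrightarrow> y \<in> A \<Longrightarrow> dist (f x) (f y) \<le> L * dist x y"
  shows "hausdorff_outer_measure k (f ` A) \<le> ennreal (L ^ k) * hausdorff_outer_measure k A"
proof (rule hausdorff_outer_measure_le)
  fix \<delta> :: real assume "0 < \<delta>"
  have "hausdorff_premeasure k \<delta> (f ` A) \<le> ennreal (L ^ k) * (\<Sum>i. hausdorff_weight k (C i))"
    if C: "A \<subseteq> (\<Union>i. C i)" "\<And>i. bounded (C i)" "\<And>i. diameter (C i) \<le> \<delta> / L"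
    for C :: "nat \<Rightarrow> 'a set"
  proof -
    have bdd: "bounded (f ` (C i \<inter> A))" for i
    proof -
      obtain e where "\<forall>x\<in>C i. \<forall>y\<in>C i. dist x y \<le> e"
        using C(2) bounded_two_points by blast
      then have "dist (f x) (f y) \<le> L * e" if "x \<in> C i \<inter> A" "y \<in> C i \<inter> A" for x y
        using that L by (meson IntD1 IntD2 mult_left_mono order_trans less_imp_le)
      then show ?thesis
        by (auto simp: bounded_two_points)
    qed
    have diam: "diameter (f ` (C i \<inter> A)) \<le> L * diameter (C i)" for i
    proof (rule diameter_le)
      fix u v assume "u \<in> f ` (C i \<inter> A)" "v \<in> f ` (C i \<inter> A)"
      then obtain x y where xy: "x \<in> C i \<inter> A" "y \<in> C i \<inter> A" "u = f x" "v = f y" by auto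
      have "dist x y \<le> diameter (C i)"
        using xy C(2) by (intro diameter_bounded_bound) auto
      with L xy show "norm (u - v) \<le> L * diameter (C i)"
        by (metis IntD2 dist_norm mult_left_mono order_trans less_imp_le)
    qed (use L C(2) diameter_ge_0 in \<open>auto intro!: mult_nonneg_nonneg\<close>)
    have "hausdorff_premeasure k \<delta> (f ` A) \<le> (\<Sum>i. hausdorff_weight k (f ` (C i \<inter> A)))"
    proof (rule hausdorff_premeasure_le)
      show "diameter (f ` (C i \<inter> A)) \<le> \<delta>" for i
        using diam[of i] C(3)[of i] L(1) by (simp add: field_simps)
    qed (use C bdd in \<open>auto, blast\<close>)
    also have "\<dots> \<le> (\<Sum>i. ennreal (L ^ k) * hausdorff_weight k (C i))"
    proof (intro suminf_le)
      fix i
      show "hausdorff_weight k (f ` (C i \<inter> A)) \<le> ennreal (L ^ k) * hausdorff_weight k (C i)"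
      proof (cases "C i \<inter> A = {}")
        case False
        have "unit_ball_vol (real k) * (diameter (f ` (C i \<inter> A)) / 2) ^ k
          \<le> unit_ball_vol (real k) * (L * diameter (C i) / 2) ^ k"
          using diam[of i] diameter_ge_0[OF bdd[of i]]
          by (intro mult_left_mono power_mono divide_right_mono) auto
        then show ?thesis
          using False L(1) C(2)
          by (auto simp: hausdorff_weight_def ennreal_mult[symmetric] diameter_ge_0 
              power_mult_distrib power_divide mult.left_commute intro!: ennreal_leI)
      qed simp
    qed auto
    finally show ?thesis by simp
  qed
  \<comment> \<open>Dividing by \<open>L ^ k\<close> moves the constant to the other side, so that
    the infimum over covers can be taken.\<close>
  then have le: "hausdorff_premeasure k \<delta> (f ` A) / ennreal (L ^ k) \<le> hausdorff_premeasure k (\<delta> / L) A"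
    using L(1) by (intro le_hausdorff_premeasure divide_le_posI_ennreal) (auto simp: mult.commute)
  have "hausdorff_premeasure k \<delta> (f ` A) = ennreal (L ^ k) * (hausdorff_premeasure k \<delta> (f ` A) / ennreal (L ^ k))"
    using L(1) by (simp add: ennreal_times_divide mult_divide_eq_ennreal mult.commute[of "ennreal _"])
  also have "\<dots> \<le> ennreal (L ^ k) * hausdorff_premeasure k (\<delta> / L) A"
    by (intro mult_left_mono le) auto
  also have "\<dots> \<le> ennreal (L ^ k) * hausdorff_outer_measure k A"
    using \<open>0 < \<delta>\<close> L(1) by (intro mult_left_mono hausdorff_premeasure_le_outer) auto
  finally show "hausdorff_premeasure k \<delta> (f ` A) \<le> ennreal (L ^ k) * hausdorff_outer_measure k A" .
qed

section \<open>Hausdorff measure in full dimension\<close>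

lemma hausdorff_outer_measure_translation:
  fixes A :: "'a::euclidean_space set"
  shows "hausdorff_outer_measure k ((+) t ` A) = hausdorff_outer_measure k A"
proof -
  have le: "hausdorff_outer_measure k ((+) t ` A) \<le> hausdorff_outer_measure k A" for t and A :: "'a set"
    using hausdorff_outer_measure_lipschitz[of 1 A "(+) t" k] by simp
  have "A = (+) (- t) ` (+) t ` A" by (auto simp: image_image)
  then show ?thesis using le[of t A] le[of "- t" "(+) t ` A"] by (metis antisym)
qed

text \<open>The cube is cut into \<open>N ^ ?k\<close> cubes of side \<open>1 / N\<close>. Their
  total weight is the constant \<open>?c\<close> whatever \<open>N\<close> is, while their diameters
  fall below any given scale.\<close>

lemma hausdorff_outer_measure_unit_cube:
  "hausdorff_outer_measure DIM('a) (cbox 0 One :: 'a::euclidean_space set) < top"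
proof -
  let ?k = "DIM('a)"
  let ?c = "unit_ball_vol (real ?k) * (sqrt ?k / 2) ^ ?k"
  have pre: "hausdorff_premeasure ?k \<delta> (cbox 0 One :: 'a set) \<le> ennreal ?c" if "0 < \<delta>" for \<delta>
  proof -
    obtain N where N: "sqrt ?k / \<delta> < real N"
      using reals_Archimedean2 by blast
    have "0 < real N"
      using N \<open>0 < \<delta>\<close> by (meson divide_nonneg_pos le_less_trans of_nat_0_le_iff real_sqrt_ge_zero)
    then have N0: "0 < N" by simp
    define I where "I = (Basis :: 'a set) \<rightarrow>\<^sub>E {..<N}"
    define a where "a f = (\<Sum>b\<in>Basis. (real (f b) / N) *\<^sub>R b)" for f :: "'a \<Rightarrow> nat"
    define C where "C f = cbox (a f) (a f + One /\<^sub>R N)" for f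
    have inner_a: "a f \<bullet> b = real (f b) / N" if "b \<in> Basis" for f b
      using that by (simp add: a_def)
    have norm_One: "norm (One :: 'a) = sqrt ?k"
      by (simp add: norm_eq_sqrt_inner inner_sum_left inner_sum_right inner_Basis sum.If_cases)
    have diam: "diameter (C f) = sqrt ?k / N" for f
      unfolding C_def using N0 by (subst diameter_cbox) (auto simp: dist_norm norm_One inner_add_left field_simps)
    have "hausdorff_premeasure ?k \<delta> (cbox 0 One :: 'a set) \<le> (\<Sum>f\<in>I. hausdorff_weight ?k (C f))"
    proof (rule hausdorff_premeasure_finite_cover)
      show "finite I" by (simp add: I_def finite_PiE)
      show "cbox 0 One \<subseteq> (\<Union>f\<in>I. C f)"
      proof
        fix x :: 'a assume x: "x \<in> cbox 0 One"
        \<comment> \<open>The minimum with \<open>N - 1\<close> assigns points on the far faces,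
          where \<open>x \<bullet> b = 1\<close>, to the last cube.\<close>
        define f where "f = restrict (\<lambda>b. min (N - 1) (nat \<lfloor>(x \<bullet> b) * N\<rfloor>)) Basis"
        have "f \<in> I" using N0 by (auto simp: f_def I_def)
        moreover have "x \<in> C f"
          unfolding C_def mem_box
        proof (intro ballI conjI)
          fix b :: 'a assume b: "b \<in> Basis"
          then have xb: "0 \<le> x \<bullet> b" "x \<bullet> b \<le> 1" using x by (auto simp: mem_box)
          let ?m = "nat \<lfloor>(x \<bullet> b) * N\<rfloor>"
          have m: "real ?m \<le> (x \<bullet> b) * N" "(x \<bullet> b) * N < real ?m + 1"
            using xb by (auto simp: of_nat_floor)
          have "real (f b) \<le> (x \<bullet> b) * N"
            using b m by (auto simp: f_def)
          then show "a f \<bullet> b \<le> x \<bullet> b"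
            using N0 b by (simp add: inner_a field_simps)
          have "(x \<bullet> b) * N \<le> real (f b) + 1"
          proof (cases "?m \<le> N - 1")
            case False
            have "(x \<bullet> b) * N \<le> N" using xb by (simp add: mult_left_le_one_le)
            then show ?thesis using False b N0 by (simp add: f_def of_nat_diff)
          qed (use b m in \<open>auto simp: f_def\<close>)
          then show "x \<bullet> b \<le> (a f + One /\<^sub>R N) \<bullet> b"
            using N0 b by (simp add: inner_a inner_add_left field_simps)
        qed
        ultimately show "x \<in> (\<Union>f\<in>I. C f)" by blast
      qed
      show "bounded (C f)" for f by (simp add: C_def)
      show "diameter (C f) \<le> \<delta>" for f
        using N N0 \<open>0 < \<delta>\<close> by (simp add: diam field_simps)
    qed (use \<open>0 < \<delta>\<close> in auto)
    also have "\<dots> \<le> (\<Sum>f\<in>I. ennreal (unit_ball_vol (real ?k) * (sqrt ?k / N / 2) ^ ?k))"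
      by (intro sum_mono) (simp add: hausdorff_weight_def diam)
    also have "\<dots> = of_nat (card I) * ennreal (unit_ball_vol (real ?k) * (sqrt ?k / N / 2) ^ ?k)"
      by simp
    also have "card I = N ^ ?k"
      by (simp add: I_def card_PiE)
    also have "of_nat (N ^ ?k) * ennreal (unit_ball_vol (real ?k) * (sqrt ?k / N / 2) ^ ?k) = ennreal ?c"
      using N0 by (simp add: ennreal_of_nat_eq_real_of_nat ennreal_mult[symmetric] power_divide power_mult_distrib field_simps)
    finally show ?thesis .
  qed
  have "hausdorff_outer_measure ?k (cbox 0 One :: 'a set) \<le> ennreal ?c"
    by (intro hausdorff_outer_measure_le pre)
  then show ?thesis by (rule le_less_trans) simp
qed

text \<open>Each covering set lies in a ball whose radius is its diameter, twice the radius that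
  enters its weight; hence the factor \<open>2 ^ DIM('a)\<close>. The estimate serves to make the
  Hausdorff measure of the unit cube positive.\<close>

lemma lborel_le_hausdorff_outer_measure:
  fixes A :: "'a::euclidean_space set"
  assumes "A \<in> sets borel"
  shows "emeasure lborel A \<le> ennreal (2 ^ DIM('a)) * hausdorff_outer_measure DIM('a) A"
proof -
  let ?k = "DIM('a)"
  have "emeasure lborel A / ennreal (2 ^ ?k) \<le> hausdorff_premeasure ?k 1 A"
  proof (intro le_hausdorff_premeasure divide_le_posI_ennreal)
    fix C :: "nat \<Rightarrow> 'a set" assume C: "A \<subseteq> (\<Union>i. C i)" "\<And>i. bounded (C i)"
    define B where "B i = (if C i = {} then {} else cball (SOME x. x \<in> C i) (diameter (C i)))" for i
    have sub: "C i \<subseteq> B i" for i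
    proof
      fix x assume x: "x \<in> C i"
      then have "(SOME x. x \<in> C i) \<in> C i" by (rule someI)
      then show "x \<in> B i"
        using x C(2)[of i] diameter_bounded_bound[of "C i" "SOME x. x \<in> C i" x] by (auto simp: B_def)
    qed
    then have "emeasure lborel A \<le> emeasure lborel (\<Union>i. B i)"
      using C(1) by (intro emeasure_mono subset_trans[OF C(1)] UN_mono) (auto simp: B_def)
    also have "\<dots> \<le> (\<Sum>i. emeasure lborel (B i))"
      by (intro emeasure_subadditive_countably) (auto simp: B_def)
    also have "\<dots> = (\<Sum>i. ennreal (2 ^ ?k) * hausdorff_weight ?k (C i))"
      using C(2) by (intro suminf_cong)
        (auto simp: B_def hausdorff_weight_def emeasure_cball diameter_ge_0 ennreal_mult[symmetric] power_divide)
    finally show "emeasure lborel A \<le> ennreal (2 ^ ?k) * (\<Sum>i. hausdorff_weight ?k (C i))"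
      by simp
  qed simp
  then have *: "emeasure lborel A / ennreal (2 ^ ?k) \<le> hausdorff_outer_measure ?k A"
    using hausdorff_premeasure_le_outer[of 1 ?k A] by simp
  have "emeasure lborel A = ennreal (2 ^ ?k) * (emeasure lborel A / ennreal (2 ^ ?k))"
    by (simp add: ennreal_times_divide mult_divide_eq_ennreal mult.commute[of "ennreal _"] ennreal_power)
  also have "\<dots> \<le> ennreal (2 ^ ?k) * hausdorff_outer_measure ?k A"
    by (intro mult_left_mono *) auto
  finally show ?thesis .
qed

text \<open>Uniqueness of Haar measure: evaluate \<open>\<integral>\<integral> 1\<^sub>A(x) 1\<^sub>B(x + y) dM(x) dy\<close> in both orders.\<close>

lemma translation_invariant_eq_lborel:
  fixes M :: "'a::euclidean_space measure"
  assumes [measurable_cong]: "sets M = sets borel"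
    and "sigma_finite_measure M"
    and inv: "\<And>t. distr M borel ((+) t) = M"
    and A [measurable]: "A \<in> sets borel" and B [measurable]: "B \<in> sets borel"
  shows "emeasure M A * emeasure lborel B = emeasure lborel A * emeasure M B"
proof -
  interpret M: sigma_finite_measure M by fact
  interpret P: pair_sigma_finite lborel M ..
  have refl: "distr lborel borel (\<lambda>y. x - y) = lborel" for x :: 'a
    using lborel_affine[of "-1" x] by (simp add: density_1)
  have "emeasure M A * emeasure lborel B = (\<integral>\<^sup>+x. indicator A x * emeasure lborel B \<partial>M)"
    by (simp add: nn_integral_multc)
  also have "\<dots> = (\<integral>\<^sup>+x. \<integral>\<^sup>+y. indicator A x * indicator B (x + y) \<partial>lborel \<partial>M)"
  proof (rule nn_integral_cong)
    fix x
    have "emeasure lborel B = emeasure (distr lborel borel ((+) x)) B"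
      by (simp add: lborel_distr_plus)
    also have "\<dots> = (\<integral>\<^sup>+y. indicator B (x + y) \<partial>lborel)"
      by (subst nn_integral_indicator[symmetric], simp, subst nn_integral_distr) auto
    finally show "indicator A x * emeasure lborel B = (\<integral>\<^sup>+y. indicator A x * indicator B (x + y) \<partial>lborel)"
      by (simp add: nn_integral_cmult)
  qed
  also have "\<dots> = (\<integral>\<^sup>+y. \<integral>\<^sup>+x. indicator A x * indicator B (x + y) \<partial>M \<partial>lborel)"
    by (rule P.Fubini') measurable
  also have "\<dots> = (\<integral>\<^sup>+y. \<integral>\<^sup>+x. indicator A (x - y) * indicator B x \<partial>M \<partial>lborel)"
  proof (rule nn_integral_cong)
    fix y
    have "(\<integral>\<^sup>+x. indicator A (x - y) * indicator B x \<partial>M)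
      = (\<integral>\<^sup>+x. indicator A (x - y) * indicator B x \<partial>distr M borel ((+) y))"
      by (simp add: inv)
    also have "\<dots> = (\<integral>\<^sup>+x. indicator A x * indicator B (x + y) \<partial>M)"
      by (subst nn_integral_distr) (auto simp: add.commute)
    finally show "(\<integral>\<^sup>+x. indicator A x * indicator B (x + y) \<partial>M) =
      (\<integral>\<^sup>+x. indicator A (x - y) * indicator B x \<partial>M)" ..
  qed
  also have "\<dots> = (\<integral>\<^sup>+x. \<integral>\<^sup>+y. indicator A (x - y) * indicator B x \<partial>lborel \<partial>M)"
    by (rule P.Fubini'[symmetric]) measurable
  also have "\<dots> = (\<integral>\<^sup>+x. emeasure lborel A * indicator B x \<partial>M)"
  proof (rule nn_integral_cong)
    fix x
    have "emeasure lborel A = emeasure (distr lborel borel (\<lambda>y. x - y)) A"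
      by (simp add: refl)
    also have "\<dots> = (\<integral>\<^sup>+y. indicator A (x - y) \<partial>lborel)"
      by (subst nn_integral_indicator[symmetric], simp, subst nn_integral_distr) auto
    finally show "(\<integral>\<^sup>+y. indicator A (x - y) * indicator B x \<partial>lborel) = emeasure lborel A * indicator B x"
      by (simp add: nn_integral_multc)
  qed
  also have "\<dots> = emeasure lborel A * emeasure M B"
    by (simp add: nn_integral_cmult)
  finally show ?thesis .
qed

text \<open>Both measures are translation invariant and sigma-finite, hence proportional;
  \<open>c\<close> is the Hausdorff measure of the unit cube. Later uses either cancel
  \<open>c\<close> or rely on its being positive and finite.\<close>

lemma hausdorff_measure_eq_lborel:
  obtains c where "0 < c"
    "\<And>A :: 'a::euclidean_space set. A \<in> sets borel \<Longrightarrow> hausdorff_outer_measure DIM('a) A = ennreal c * emeasure lborel A"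
proof -
  let ?M = "hausdorff_measure DIM('a) :: 'a measure"
  let ?H = "hausdorff_outer_measure DIM('a) :: 'a set \<Rightarrow> ennreal"
  let ?Q = "cbox 0 One :: 'a set"
  have translate: "emeasure ?M ((+) t -` A) = emeasure ?M A" if "A \<in> sets borel" for t A
  proof -
    have "(+) t -` A = (+) (- t) ` A" by (force simp: image_iff simp del: add_uminus_conv_diff)
    moreover have "(+) t -` A \<in> sets borel"
      using that measurable_sets[of "(+) t" borel borel A] by simp
    ultimately show ?thesis
      using that hausdorff_outer_measure_translation[of "DIM('a)" "- t" A]
      by (simp add: emeasure_hausdorff_measure del: add_uminus_conv_diff)
  qed
  have inv: "distr ?M borel ((+) t) = ?M" for t
    by (rule measure_eqI) (auto simp: emeasure_distr translate)
  have "sigma_finite_measure ?M"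
  proof
    obtain D :: "'a set" where D: "countable D" "\<And>X. open X \<Longrightarrow> X \<noteq> {} \<Longrightarrow> \<exists>d\<in>D. d \<in> X"
      using countable_dense_exists by blast
    have Q: "emeasure ?M ((+) d ` ?Q) < top" "(+) d ` ?Q \<in> sets borel" for d :: 'a
    proof -
      show "(+) d ` ?Q \<in> sets borel"
        by (simp add: cbox_translation[symmetric])
      then show "emeasure ?M ((+) d ` ?Q) < top"
        using hausdorff_outer_measure_unit_cube[where 'a='a]
        by (simp add: emeasure_hausdorff_measure hausdorff_outer_measure_translation)
    qed
    have "x \<in> (\<Union>d\<in>D. (+) d ` ?Q)" for x
    proof -
      \<comment> \<open>A point \<open>d\<close> of the dense set just below \<open>x\<close> in
        every coordinate puts \<open>x - d\<close> into the unit cube, so countably many translates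
        cover the space.\<close>
      have "box (x - One) x \<noteq> {}"
        by (auto simp: box_ne_empty inner_diff_left)
      then obtain d where "d \<in> D" "d \<in> box (x - One) x"
        using D(2)[of "box (x - One) x"] by auto
      then show ?thesis
        by (intro UN_I[of d] image_eqI[of _ _ "x - d"]) (auto simp: mem_box inner_diff_left algebra_simps less_imp_le)
    qed
    then show "\<exists>A. countable A \<and> A \<subseteq> sets ?M \<and> \<Union> A = space ?M \<and> (\<forall>a\<in>A. emeasure ?M a \<noteq> \<infinity>)"
      using D(1) Q by (intro exI[of _ "(\<lambda>d. (+) d ` ?Q) ` D"]) (auto simp: less_top)
  qed
  note haar = translation_invariant_eq_lborel[OF sets_hausdorff_measure this inv, of _ ?Q]
  have unit: "emeasure lborel ?Q = 1" by (simp add: emeasure_lborel_cbox_eq)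
  have eq: "?H A = ?H ?Q * emeasure lborel A" if "A \<in> sets borel" for A
    using haar[OF that] that unit by (simp add: emeasure_hausdorff_measure mult.commute)
  have "0 < ?H ?Q"
    using lborel_le_hausdorff_outer_measure[of ?Q] unit by (auto simp: zero_less_iff_neq_zero)
  moreover have "?H ?Q < top" by (rule hausdorff_outer_measure_unit_cube)
  ultimately obtain c where c: "?H ?Q = ennreal c" "0 < c"
    by (cases "?H ?Q" rule: ennreal_cases) auto
  show thesis
    by (rule that[of c, OF c(2)]) (simp only: eq c(1))
qed

lemma emeasure_lborel_stretch:
  fixes A :: "'a::euclidean_space set"
  assumes b: "b \<in> Basis" and s: "0 < s" and A: "A \<in> sets borel"
  defines "D \<equiv> \<lambda>x. x + ((s - 1) * (x \<bullet> b)) *\<^sub>R b"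
  shows "D ` A \<in> sets borel" and "emeasure lborel (D ` A) = ennreal s * emeasure lborel A"
proof -
  \<comment> \<open>\<open>E\<close> is the inverse stretching. It turns the image under
    \<open>D\<close> into a preimage, which is Borel.\<close>
  define E where "E x = x + ((1 / s - 1) * (x \<bullet> b)) *\<^sub>R b" for x
  have Dx: "D x = x + ((s - 1) * (x \<bullet> b)) *\<^sub>R b" for x by (simp add: D_def)
  have bb: "b \<bullet> b = 1" using b by simp
  have DE: "D (E x) = x" "E (D x) = x" for x :: 'a
  proof -
    have "E x \<bullet> b = (x \<bullet> b) / s" "D x \<bullet> b = s * (x \<bullet> b)"
      using s by (auto simp: D_def E_def inner_add_left bb diff_divide_distrib left_diff_distrib)
    then have "D (E x) = x + ((1 / s - 1) * (x \<bullet> b) + (s - 1) * ((x \<bullet> b) / s)) *\<^sub>R b"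
      "E (D x) = x + ((s - 1) * (x \<bullet> b) + (1 / s - 1) * (s * (x \<bullet> b))) *\<^sub>R b"
      by (simp_all add: Dx[of "E x"] E_def[of "D x"]) (simp_all add: Dx E_def scaleR_add_left)
    moreover have "(1 / s - 1) * (x \<bullet> b) + (s - 1) * ((x \<bullet> b) / s) = 0"
      "(s - 1) * (x \<bullet> b) + (1 / s - 1) * (s * (x \<bullet> b)) = 0"
      using s by (auto simp: field_simps)
    ultimately show "D (E x) = x" "E (D x) = x" by simp_all
  qed
  have img: "D ` A = E -` A"
    using DE by (metis (no_types, lifting) image_eqI subsetI subset_antisym vimageE vimageI2 imageE)
  have [measurable]: "E \<in> borel_measurable borel" "D \<in> borel_measurable borel"
    unfolding E_def[abs_def] D_def by measurable
  show DA: "D ` A \<in> sets borel"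
    unfolding img using A measurable_sets[of E borel borel A] by simp
  \<comment> \<open>\<open>D\<close> is the diagonal map with factors \<open>c\<close>, so the
    change of variables has Jacobian \<open>s\<close>.\<close>
  define c where "c j = (if j = b then s else 1)" for j :: 'a
  have T: "0 + (\<Sum>j\<in>Basis. (c j * (x \<bullet> j)) *\<^sub>R j) = D x" for x
  proof -
    have "(\<Sum>j\<in>Basis. (c j * (x \<bullet> j)) *\<^sub>R j)
      = (\<Sum>j\<in>Basis. (x \<bullet> j) *\<^sub>R j + (if j = b then ((s - 1) * (x \<bullet> b)) *\<^sub>R b else 0))"
      by (intro sum.cong) (auto simp: c_def algebra_simps)
    then show ?thesis
      using b by (simp add: sum.distrib euclidean_representation D_def)
  qed
  have "lborel = density (distr lborel borel D) (\<lambda>_. ennreal (\<Prod>j\<in>Basis. \<bar>c j\<bar>))"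
    using lborel_affine_euclidean[of c 0] s unfolding T by (auto simp: c_def)
  moreover have "(\<Prod>j\<in>Basis. \<bar>c j\<bar>) = s"
    using b s by (simp add: c_def if_distrib prod.delta cong: if_cong)
  ultimately have "emeasure lborel (D ` A) = emeasure (density (distr lborel borel D) (\<lambda>_. ennreal s)) (D ` A)"
    by simp
  also have "\<dots> = ennreal s * emeasure lborel (D -` D ` A)"
    using DA by (simp add: emeasure_density nn_integral_cmult_indicator emeasure_distr)
  also have "D -` D ` A = A"
    using DE by (metis inj_on_inverseI inj_vimage_image_eq)
  finally show "emeasure lborel (D ` A) = ennreal s * emeasure lborel A" .
qed

lemma hausdorff_outer_measure_stretch:
  fixes A :: "'a::euclidean_space set"
  assumes "b \<in> Basis" "0 < s" "A \<in> sets borel"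
  shows "hausdorff_outer_measure DIM('a) ((\<lambda>x. x + ((s - 1) * (x \<bullet> b)) *\<^sub>R b) ` A)
    = ennreal s * hausdorff_outer_measure DIM('a) A"
proof -
  obtain c where c: "\<And>A :: 'a set. A \<in> sets borel \<Longrightarrow>
      hausdorff_outer_measure DIM('a) A = ennreal c * emeasure lborel A"
    using hausdorff_measure_eq_lborel by metis
  show ?thesis
    using emeasure_lborel_stretch[OF assms] assms(3) by (simp add: c mult.left_commute)
qed

section \<open>Local charts of level sets\<close>

text \<open>\<open>q\<close> is injective on \<open>A\<close> and its inverse is
  \<open>L\<close>-Lipschitz. In this form a chart of a level set bounds the measure of the level
  set from above.\<close>

lemma hausdorff_outer_measure_expanding:
  fixes q :: "'a::euclidean_space \<Rightarrow> 'b::euclidean_space"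
  assumes L: "0 < L" "\<And>x y. x \<in> A \<Longrightarrow> y \<in> A \<Longrightarrow> dist x y \<le> L * dist (q x) (q y)"
  shows "hausdorff_outer_measure k A \<le> ennreal (L ^ k) * hausdorff_outer_measure k (q ` A)"
proof -
  have "inj_on q A"
  proof
    fix x y assume "x \<in> A" "y \<in> A" "q x = q y"
    then show "x = y" using L(2)[of x y] by simp
  qed
  then have inv: "inv_into A q (q x) = x" if "x \<in> A" for x
    using that by simp
  then have "A = inv_into A q ` q ` A" by (force simp: image_image)
  moreover have "hausdorff_outer_measure k (inv_into A q ` q ` A) \<le> ennreal (L ^ k) * hausdorff_outer_measure k (q ` A)"
    using L inv by (intro hausdorff_outer_measure_lipschitz) auto
  ultimately show ?thesis by simp
qed

text \<open>A continuous injection of a compact set is a homeomorphism onto a closed set, so the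
  image of \<open>A\<close> is a preimage under the continuous inverse.\<close>

lemma borel_image_subset_compact:
  fixes f :: "'a::t2_space \<Rightarrow> 'b::t2_space"
  assumes K: "compact K" "continuous_on K f" "inj_on f K"
    and A: "A \<in> sets borel" "A \<subseteq> K"
  shows "f ` A \<in> sets borel"
proof -
  obtain g where g: "homeomorphism K (f ` K) f g"
    using homeomorphism_compact[OF K(1,2) refl K(3)] by blast
  have fK: "closed (f ` K)"
    using K by (intro compact_imp_closed compact_continuous_image)
  have "g -` A \<inter> space (restrict_space borel (f ` K)) \<in> sets (restrict_space borel (f ` K))"
    using g by (intro measurable_sets[OF borel_measurable_continuous_on_restrict A(1)])
      (simp add: homeomorphism_def)
  then have "g -` A \<inter> f ` K \<in> sets borel"
    using fK by (simp add: space_restrict_space sets_restrict_space_iff)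
  also have "g -` A \<inter> f ` K = f ` A"
    using g A(2) by (auto simp: homeomorphism_def image_iff subset_iff; metis)
  finally show ?thesis .
qed

text \<open>\<open>p\<close> is the orthogonal projection along \<open>w\<close> followed by a
  linear isometry of the hyperplane onto \<open>'b\<close>. Having a Euclidean type of the right
  dimension as target makes the comparison with Lebesgue measure available.\<close>

lemma hyperplane_isometry:
  fixes w :: "'a::euclidean_space"
  assumes w: "norm w = 1" and dim: "DIM('a) = Suc DIM('b)"
  obtains p :: "'a \<Rightarrow> 'b::euclidean_space" where "linear p" "\<And>x y. p x \<bullet> p y = x \<bullet> y - (x \<bullet> w) * (y \<bullet> w)"
    "\<And>u. \<exists>x. x \<bullet> w = 0 \<and> p x = u"
proof -
  let ?V = "{x. w \<bullet> x = 0}"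
  have w1: "w \<bullet> w = 1" using w by (simp add: norm_eq_1)
  have "dim ?V = dim (UNIV :: 'b set)"
    using w dim by (subst dim_hyperplane) auto
  then obtain f g where f: "linear f" "f ` ?V = (UNIV :: 'b set)" "\<And>x. x \<in> ?V \<Longrightarrow> norm (f x) = norm x"
    using isometries_subspaces[OF subspace_hyperplane[of w] subspace_UNIV] by metis
  define P where "P x = x - (x \<bullet> w) *\<^sub>R w" for x
  have P: "linear P" "P x \<in> ?V" for x
    unfolding P_def using w1
    by (auto intro!: linearI simp: algebra_simps inner_add_left inner_diff_right inner_commute)
  have PP: "P x \<bullet> P y = x \<bullet> y - (x \<bullet> w) * (y \<bullet> w)" for x y
    using w1 by (simp add: P_def algebra_simps inner_diff_left inner_diff_right inner_commute)
  have lin: "linear (f \<circ> P)" using P f by (simp add: linear_compose)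
  have nrm: "norm ((f \<circ> P) x) = norm (P x)" for x
    using f(3)[OF P(2)] by simp
  \<comment> \<open>The isometry is known to preserve norms; inner products follow by
    polarisation.\<close>
  have "(f \<circ> P) x \<bullet> (f \<circ> P) y = P x \<bullet> P y" for x y
  proof -
    have "norm ((f \<circ> P) (x + y)) = norm (P (x + y))" by (rule nrm)
    then have "norm ((f \<circ> P) x + (f \<circ> P) y) = norm (P x + P y)"
      using linear_add[OF lin] linear_add[OF P(1)] by simp
    then show ?thesis
      by (simp only: dot_norm nrm)
  qed
  moreover have "\<exists>x. x \<bullet> w = 0 \<and> (f \<circ> P) x = u" for u
  proof -
    obtain x where "x \<in> ?V" "u = f x"
      using f(2) by (metis (no_types, lifting) UNIV_I imageE)
    then show ?thesis
      by (intro exI[of _ x]) (auto simp: P_def inner_commute)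
  qed
  ultimately show thesis
    using lin PP by (intro that[of "f \<circ> P"]) auto
qed

text \<open>\<open>D \<circ> p\<close> is isometric to the projection along \<open>w\<close> onto the hyperplane orthogonal to \<open>n\<close>;
  it stretches a single direction of the hyperplane orthogonal to \<open>w\<close> by the factor \<open>1 / (n \<bullet> w)\<close>.\<close>

lemma oblique_projection_chart:
  fixes w n :: "'a::euclidean_space"
  assumes w: "norm w = 1" and n: "norm n = 1" and pos: "0 < n \<bullet> w"
    and dim: "DIM('a) = Suc CARD('m::finite)"
  obtains p :: "'a \<Rightarrow> real ^ 'm" and D :: "real ^ 'm \<Rightarrow> real ^ 'm"
  where "linear p" "linear D" "\<And>x. norm (p x) \<le> norm x"
    "\<And>x. norm (D (p x)) = norm (x - ((x \<bullet> n) / (n \<bullet> w)) *\<^sub>R w)"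
    "\<And>B. B \<in> sets borel \<Longrightarrow>
      hausdorff_outer_measure CARD('m) (D ` B) = ennreal (1 / (n \<bullet> w)) * hausdorff_outer_measure CARD('m) B"
proof -
  define \<alpha> where "\<alpha> = n \<bullet> w"
  have w1: "w \<bullet> w = 1" "n \<bullet> n = 1" using w n by (simp_all add: norm_eq_1)
  obtain p0 :: "'a \<Rightarrow> real ^ 'm" where p0: "linear p0"
    "\<And>x y. p0 x \<bullet> p0 y = x \<bullet> y - (x \<bullet> w) * (y \<bullet> w)"
  proof (rule hyperplane_isometry[OF w, where 'b="real ^ 'm"])
    show "DIM('a) = Suc DIM(real ^ 'm)" using dim by simp
  qed (rule that)
  define b :: "real ^ 'm" where "b = (SOME b. b \<in> Basis)"
  have b: "b \<in> Basis" unfolding b_def by (rule SOME_Basis)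
  then have bb: "b \<bullet> b = 1" by simp
  define l where "l = norm (p0 n)"
  have l2: "l\<^sup>2 = 1 - \<alpha>\<^sup>2"
    using p0(2)[of n n] w1 unfolding l_def power2_norm_eq_inner
    by (simp add: \<alpha>_def power2_eq_square)
  \<comment> \<open>The direction to be stretched is that of the projected \<open>n\<close>. The
    orthogonal map \<open>Q\<close> turns it into a coordinate axis, where
    \<open>hausdorff_outer_measure_stretch\<close> applies.\<close>
  have "norm (p0 n) = norm (l *\<^sub>R b)" using b by (simp add: l_def)
  then obtain Q where Q: "orthogonal_transformation Q" "Q (p0 n) = l *\<^sub>R b"
    by (rule orthogonal_transformation_exists)
  define p where "p = Q \<circ> p0"
  define D where "D x = x + ((1 / \<alpha> - 1) * (x \<bullet> b)) *\<^sub>R b" for x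
  have pp: "p x \<bullet> p y = x \<bullet> y - (x \<bullet> w) * (y \<bullet> w)" for x y
    using Q(1) p0(2) by (simp add: p_def orthogonal_transformation_def)
  have "linear p"
    using p0(1) Q(1) by (simp add: p_def linear_compose orthogonal_transformation_linear)
  moreover have "linear D"
    unfolding D_def by (auto intro!: linearI simp: algebra_simps inner_add_left add_divide_distrib)
  moreover have "norm (p x) \<le> norm x" for x
    unfolding norm_le pp by simp
  moreover have "norm (D (p x)) = norm (x - ((x \<bullet> n) / (n \<bullet> w)) *\<^sub>R w)" for x
  proof -
    define s where "s = x \<bullet> w"
    define t where "t = x \<bullet> n"
    have a: "\<alpha> > 0" using pos by (simp add: \<alpha>_def)
    have "p x \<bullet> p n = l * (p x \<bullet> b)"
      using Q(2) by (simp add: p_def)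
    \<comment> \<open>Working with \<open>l * (p x \<bullet> b)\<close> avoids a division by
      \<open>l\<close>, which vanishes when \<open>n = w\<close>; the factor
      \<open>1 / \<alpha>\<^sup>2 - 1\<close> below equals
      \<open>l\<^sup>2 / \<alpha>\<^sup>2\<close>.\<close>
    then have lb: "l * (p x \<bullet> b) = t - s * \<alpha>"
      using pp[of x n] by (simp add: s_def t_def \<alpha>_def)
    have "D (p x) \<bullet> D (p x) = p x \<bullet> p x + (1 / \<alpha>\<^sup>2 - 1) * (p x \<bullet> b)\<^sup>2"
      by (simp add: D_def inner_add_left inner_add_right bb inner_commute)
         (simp add: power2_eq_square algebra_simps)
    also have "(1 / \<alpha>\<^sup>2 - 1) * (p x \<bullet> b)\<^sup>2 = (l * (p x \<bullet> b))\<^sup>2 / \<alpha>\<^sup>2"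
      using a by (simp add: l2 power_mult_distrib field_simps)
    also have "p x \<bullet> p x + (l * (p x \<bullet> b))\<^sup>2 / \<alpha>\<^sup>2 = x \<bullet> x - s\<^sup>2 + (t - s * \<alpha>)\<^sup>2 / \<alpha>\<^sup>2"
      unfolding lb pp by (simp add: s_def power2_eq_square)
    also have "\<dots> = x \<bullet> x - 2 * (t / \<alpha>) * s + (t / \<alpha>)\<^sup>2"
      using a by (simp add: field_simps power2_eq_square)
    also have "\<dots> = (x - (t / \<alpha>) *\<^sub>R w) \<bullet> (x - (t / \<alpha>) *\<^sub>R w)"
      using w1 by (simp add: inner_diff_left inner_diff_right inner_commute s_def power2_eq_square)
    finally show ?thesis
      unfolding norm_eq t_def \<alpha>_def .
  qed
  moreover have "hausdorff_outer_measure CARD('m) (D ` B) = ennreal (1 / (n \<bullet> w)) * hausdorff_outer_measure CARD('m) B"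
    if "B \<in> sets borel" for B
    using hausdorff_outer_measure_stretch[OF b _ that, of "1 / \<alpha>"] pos
    unfolding D_def by (simp add: \<alpha>_def)
  ultimately show thesis by (rule that)
qed

text \<open>This is the mean value inequality for \<open>G z - z \<bullet> v\<close>, whose gradient
  is \<open>g z - v\<close>; the values of \<open>G\<close> cancel on a level set. With
  \<open>v\<close> the gradient at a point, short chords of the level set near it are almost
  orthogonal to \<open>v\<close>.\<close>

lemma level_set_difference_bound:
  fixes G :: "'a::euclidean_space \<Rightarrow> real"
  assumes G: "\<And>y. GDERIV G y :> g y"
    and S: "convex S" "x \<in> S" "y \<in> S" "G x = G y"
    and B: "\<And>z. z \<in> S \<Longrightarrow> norm (g z - v) \<le> B"
  shows "\<bar>(x - y) \<bullet> v\<bar> \<le> B * norm (x - y)"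
proof -
  have "norm ((G x - x \<bullet> v) - (G y - y \<bullet> v)) \<le> B * norm (x - y)"
  proof (rule differentiable_bound[OF S(1)])
    fix z assume z: "z \<in> S"
    show "((\<lambda>z. G z - z \<bullet> v) has_derivative (\<lambda>h. h \<bullet> (g z - v))) (at z within S)"
      unfolding inner_diff_right
      using has_derivative_at_withinI[OF G[of z, unfolded gderiv_def]]
        has_derivative_inner_left[OF has_derivative_ident]
      by (rule has_derivative_diff)
    show "onorm (\<lambda>h. h \<bullet> (g z - v)) \<le> B"
    proof (rule onorm_le)
      fix h :: 'a
      have "norm (h \<bullet> (g z - v)) \<le> norm h * norm (g z - v)"
        using Cauchy_Schwarz_ineq2 by simp
      also have "\<dots> \<le> norm h * B"
        by (intro mult_left_mono B z) auto
      finally show "norm (h \<bullet> (g z - v)) \<le> B * norm h" by (simp add: mult.commute)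
    qed
  qed (use S in auto)
  then show ?thesis using S(4) by (simp add: inner_diff_left)
qed

text \<open>Infinitesimally, \<open>u\<close> scales lengths across the direction of
  \<open>y0\<close> by \<open>r / norm y0\<close>, and projecting the tangent plane of the level set
  along \<open>y0\<close> reduces area by the cosine of the angle between \<open>g y0\<close> and
  \<open>y0\<close>. The constant collects the reciprocals of these factors, and
  \<open>\<eta>\<close> absorbs the error on a small ball.\<close>

lemma level_set_local_chart:
  fixes G :: "'a::euclidean_space \<Rightarrow> real" and g :: "'a \<Rightarrow> 'a" and y0 :: 'a
  assumes G: "\<And>y. GDERIV G y :> g y" and g: "continuous_on UNIV g"
    and y0: "0 < g y0 \<bullet> y0" and r: "0 < r" and \<eta>: "1 < \<eta>"
    and dim: "DIM('a) = Suc CARD('m::finite)"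
  defines "u \<equiv> \<lambda>y. (r / norm y) *\<^sub>R y"
  obtains \<rho> and p :: "'a \<Rightarrow> real ^ 'm" where "0 < \<rho>" "linear p" "\<And>x. norm (p x) \<le> norm x"
    "\<And>A. A \<in> sets borel \<Longrightarrow> A \<subseteq> {y. G y = \<tau>} \<inter> ball y0 \<rho> \<Longrightarrow>
      (\<lambda>y. p (u y)) ` A \<in> sets borel \<and>
      hausdorff_outer_measure CARD('m) A
        \<le> ennreal ((\<eta> * norm y0 / r) ^ CARD('m) * (norm (g y0) * norm y0 / (g y0 \<bullet> y0)))
           * hausdorff_outer_measure CARD('m) ((\<lambda>y. p (u y)) ` A)"
proof -
  have nz: "y0 \<noteq> 0" "g y0 \<noteq> 0" using y0 by auto
  define w where "w = y0 /\<^sub>R norm y0"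
  define n where "n = g y0 /\<^sub>R norm (g y0)"
  define \<alpha> where "\<alpha> = n \<bullet> w"
  have wn: "norm w = 1" "norm n = 1" using nz by (auto simp: w_def n_def)
  have \<alpha>_eq: "\<alpha> = (g y0 \<bullet> y0) / (norm (g y0) * norm y0)"
    by (simp add: \<alpha>_def n_def w_def divide_inverse)
  have \<alpha>: "0 < \<alpha>" unfolding \<alpha>_eq using y0 nz by simp
  \<comment> \<open>The projection along \<open>w\<close> onto the hyperplane orthogonal to
    \<open>n\<close>: it kills the radial direction at \<open>y0\<close> and fixes the tangent
    directions of the level set there.\<close>
  define N where "N x = x - ((x \<bullet> n) / \<alpha>) *\<^sub>R w" for x
  have N_lin: "linear N"
    unfolding N_def by (auto intro!: linearI simp: algebra_simps inner_add_left add_divide_distrib)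
  obtain p :: "'a \<Rightarrow> real ^ 'm" and D :: "real ^ 'm \<Rightarrow> real ^ 'm"
    where p: "linear p" "linear D" "\<And>x. norm (p x) \<le> norm x" "\<And>x. norm (D (p x)) = norm (N x)"
    "\<And>B. B \<in> sets borel \<Longrightarrow>
      hausdorff_outer_measure CARD('m) (D ` B) = ennreal (1 / \<alpha>) * hausdorff_outer_measure CARD('m) B"
    using oblique_projection_chart[OF wn \<alpha>[unfolded \<alpha>_def] dim] unfolding N_def \<alpha>_def by metis
  \<comment> \<open>Chosen to satisfy \<open>\<epsilon>_eq\<close>, which turns the errors
    accumulated in \<open>key\<close> into exactly the factor \<open>\<eta>\<close>.\<close>
  define \<epsilon> where "\<epsilon> = (\<eta> - 1) / (1 + \<eta> * (1 / \<alpha> + 1))"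
  have den: "0 < 1 + \<eta> * (1 / \<alpha> + 1)" using \<alpha> \<eta> by (intro add_pos_pos mult_pos_pos) auto
  have \<epsilon>: "0 < \<epsilon>" using den \<eta> by (simp add: \<epsilon>_def)
  have "\<epsilon> * (1 + \<eta> * (1 / \<alpha> + 1)) = \<eta> - 1" using den by (simp add: \<epsilon>_def)
  then have \<epsilon>_eq: "1 + \<epsilon> = \<eta> * (1 - \<epsilon> / \<alpha> - \<epsilon>)" by (simp add: algebra_simps)
  then have \<epsilon>2: "0 < 1 - \<epsilon> / \<alpha> - \<epsilon>"
    using \<epsilon> \<eta> by (metis add_pos_pos less_trans zero_less_mult_pos zero_less_one)
  have u_y0: "u y0 = r *\<^sub>R w" by (simp add: u_def w_def divide_inverse)
  have "N w = 0" using \<alpha> by (simp add: N_def \<alpha>_def inner_commute)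
  then have N_y0: "N (u y0) = 0" using linear_scale[OF N_lin] by (simp add: u_y0)
  have cu: "isCont u y" if "y \<noteq> 0" for y
    unfolding u_def using that by (intro continuous_intros) auto
  have N_cont: "isCont N x" for x
    unfolding N_def by (intro continuous_intros) (use \<alpha> in auto)
  have lim1: "((\<lambda>y. norm (N (u y))) \<longlongrightarrow> norm (N (u y0))) (at y0)"
    using isCont_o2[OF cu[OF nz(1)] N_cont] by (intro tendsto_norm) (simp add: isCont_def)
  have lim2: "(norm \<longlongrightarrow> norm y0) (at y0)"
    by (intro tendsto_intros)
  have lim3: "((\<lambda>y. norm (g y - g y0)) \<longlongrightarrow> 0) (at y0)"
    using g by (intro tendsto_norm_zero LIM_zero) (auto simp: continuous_on_eq_continuous_at isCont_def)
  have ev: "\<forall>\<^sub>F y in at y0. norm (N (u y)) < r * \<epsilon>" "\<forall>\<^sub>F y in at y0. norm y < norm y0 * (1 + \<epsilon>)"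
    "\<forall>\<^sub>F y in at y0. norm (g y - g y0) < \<epsilon> * norm (g y0)" "\<forall>\<^sub>F y in at y0. 0 < norm y"
    using order_tendstoD(2)[OF lim1, of "r * \<epsilon>"] order_tendstoD(2)[OF lim2, of "norm y0 * (1 + \<epsilon>)"]
      order_tendstoD(2)[OF lim3, of "\<epsilon> * norm (g y0)"] order_tendstoD(1)[OF lim2, of 0] N_y0 r \<epsilon> nz
    by auto
  have "\<forall>\<^sub>F y in nhds y0. norm (N (u y)) < r * \<epsilon> \<and> norm y < norm y0 * (1 + \<epsilon>) \<and>
      norm (g y - g y0) < \<epsilon> * norm (g y0) \<and> 0 < norm y"
    unfolding eventually_nhds_conv_at using ev N_y0 r \<epsilon> nz by (auto simp: eventually_conj_iff)
  then obtain d where d: "0 < d" "\<And>y. dist y y0 < d \<Longrightarrow> norm (N (u y)) < r * \<epsilon> \<and> norm y < norm y0 * (1 + \<epsilon>) \<and>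
      norm (g y - g y0) < \<epsilon> * norm (g y0) \<and> 0 < norm y"
    unfolding eventually_nhds_metric by blast
  have key: "r * norm (y - y') \<le> norm y0 * \<eta> * norm (D (p (u y)) - D (p (u y')))"
    if y: "dist y y0 < d" "dist y' y0 < d" "G y = G y'" for y y'
  proof -
    define v where "v = y - y'"
    define W where "W = u y - u y'"
    \<comment> \<open>The chord \<open>v\<close> is nearly tangent at \<open>y0\<close>, so
      \<open>N\<close> loses little of its length.\<close>
    have "\<bar>v \<bullet> g y0\<bar> \<le> \<epsilon> * norm (g y0) * norm v"
      unfolding v_def using y d(2)
      by (intro level_set_difference_bound[OF G, of "ball y0 d"]) (auto simp: dist_commute intro: less_imp_le)
    then have "\<bar>v \<bullet> n\<bar> \<le> \<epsilon> * norm v"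
      using nz by (simp add: n_def abs_mult field_simps)
    then have "\<bar>v \<bullet> n\<bar> / \<alpha> \<le> \<epsilon> * norm v / \<alpha>"
      using \<alpha> by (intro divide_right_mono) auto
    moreover have "norm v \<le> norm (N v) + \<bar>v \<bullet> n\<bar> / \<alpha>"
    proof -
      have "v = N v + ((v \<bullet> n) / \<alpha>) *\<^sub>R w" by (simp add: N_def)
      then have "norm v \<le> norm (N v) + norm (((v \<bullet> n) / \<alpha>) *\<^sub>R w)"
        using norm_triangle_ineq by metis
      then show ?thesis using wn \<alpha> by simp
    qed
    ultimately have 1: "norm v * (1 - \<epsilon> / \<alpha>) \<le> norm (N v)"
      by (simp add: algebra_simps)
    have y_nz: "norm y > 0" "norm y' > 0" using d(2) y by auto
    \<comment> \<open>This splits the chord into an angular part \<open>W\<close> and a part along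
      \<open>u y'\<close>, which \<open>N\<close> almost annihilates because
      \<open>N (u y0) = 0\<close>.\<close>
    have "norm y *\<^sub>R W + (norm y - norm y') *\<^sub>R u y' = norm y *\<^sub>R u y - norm y' *\<^sub>R u y'"
      by (simp add: W_def algebra_simps)
    also have "\<dots> = r *\<^sub>R v"
      using y_nz by (simp add: u_def v_def scaleR_diff_right)
    finally have "r *\<^sub>R N v = norm y *\<^sub>R N W + (norm y - norm y') *\<^sub>R N (u y')"
      by (metis linear_scale[OF N_lin] linear_add[OF N_lin])
    then have "r * norm (N v) = norm (norm y *\<^sub>R N W + (norm y - norm y') *\<^sub>R N (u y'))"
      using r by (metis abs_of_pos norm_scaleR)
    also have "\<dots> \<le> norm y * norm (N W) + \<bar>norm y - norm y'\<bar> * norm (N (u y'))"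
      using norm_triangle_ineq[of "norm y *\<^sub>R N W" "(norm y - norm y') *\<^sub>R N (u y')"] by simp
    also have "\<dots> \<le> norm y0 * (1 + \<epsilon>) * norm (N W) + norm v * (r * \<epsilon>)"
      using d(2)[OF y(1)] d(2)[OF y(2)] norm_triangle_ineq3[of y y'] \<epsilon>
      by (intro add_mono mult_mono) (auto simp: v_def)
    finally have "r * (norm v * (1 - \<epsilon> / \<alpha>)) \<le> norm y0 * (1 + \<epsilon>) * norm (N W) + norm v * (r * \<epsilon>)"
      using mult_left_mono[OF 1, of r] r by linarith
    then have "(1 - \<epsilon> / \<alpha> - \<epsilon>) * (r * norm v) \<le> norm y0 * (1 + \<epsilon>) * norm (N W)"
      by (simp add: algebra_simps)
    also have "\<dots> = (1 - \<epsilon> / \<alpha> - \<epsilon>) * (norm y0 * \<eta> * norm (N W))"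
      by (simp add: \<epsilon>_eq)
    finally have "r * norm v \<le> norm y0 * \<eta> * norm (N W)"
      using \<epsilon>2 by (simp add: mult_le_cancel_left_pos)
    also have "norm (N W) = norm (D (p (u y)) - D (p (u y')))"
      unfolding p(4)[symmetric] W_def by (simp add: linear_diff[OF p(1)] linear_diff[OF p(2)])
    finally show ?thesis by (simp add: v_def)
  qed
  \<comment> \<open>The closed ball of half the radius makes \<open>K\<close> compact, as
    \<open>borel_image_subset_compact\<close> demands, while \<open>key\<close> still holds on
    it.\<close>
  define K where "K = {y. G y = \<tau>} \<inter> cball y0 (d / 2)"
  have K_dist: "dist y y0 < d" if "y \<in> K" for y
    using that d(1) by (auto simp: K_def dist_commute)
  have G_cont: "continuous_on UNIV G"
    using G by (auto simp: gderiv_def continuous_on_eq_continuous_at intro: has_derivative_continuous)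
  have K: "compact K"
    unfolding K_def using continuous_closed_vimage[of "{\<tau>}" G] G_cont
    by (intro closed_Int_compact) (auto simp: continuous_on_eq_continuous_at vimage_def)
  have inj: "inj_on (\<lambda>y. p (u y)) K"
  proof
    fix x y assume xy: "x \<in> K" "y \<in> K" "p (u x) = p (u y)"
    then have "r * norm (x - y) \<le> 0"
      using key[OF K_dist K_dist, of x y] by (simp add: K_def)
    then show "x = y" using r by (simp add: mult_le_0_iff)
  qed
  have cont: "continuous_on K (\<lambda>y. p (u y))"
  proof -
    have "continuous_on K u"
      using cu d(2) K_dist by (intro continuous_at_imp_continuous_on ballI) auto
    then show ?thesis
      using linear_continuous_on[of p UNIV] p(1)
      by (auto intro!: continuous_on_compose2[of UNIV p] simp: linear_conv_bounded_linear)
  qed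
  show thesis
  proof (rule that[of "d / 2" p])
    fix A :: "'a set" assume A: "A \<in> sets borel" "A \<subseteq> {y. G y = \<tau>} \<inter> ball y0 (d / 2)"
    then have AK: "A \<subseteq> K" by (auto simp: K_def)
    have B: "(\<lambda>y. p (u y)) ` A \<in> sets borel"
      by (rule borel_image_subset_compact[OF K cont inj A(1) AK])
    have "hausdorff_outer_measure CARD('m) A
      \<le> ennreal ((\<eta> * norm y0 / r) ^ CARD('m)) * hausdorff_outer_measure CARD('m) ((\<lambda>y. D (p (u y))) ` A)"
    proof (rule hausdorff_outer_measure_expanding)
      show "0 < \<eta> * norm y0 / r" using \<eta> nz r by simp
      fix x y assume "x \<in> A" "y \<in> A"
      then have xy: "x \<in> K" "y \<in> K" using AK by auto
      then have "G x = G y" by (simp add: K_def)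
      from key[OF K_dist[OF xy(1)] K_dist[OF xy(2)] this]
      show "dist x y \<le> \<eta> * norm y0 / r * dist (D (p (u x))) (D (p (u y)))"
        using r by (simp add: dist_norm field_simps)
    qed
    also have "(\<lambda>y. D (p (u y))) ` A = D ` (\<lambda>y. p (u y)) ` A" by (simp add: image_image)
    also have "hausdorff_outer_measure CARD('m) (D ` (\<lambda>y. p (u y)) ` A)
      = ennreal (1 / \<alpha>) * hausdorff_outer_measure CARD('m) ((\<lambda>y. p (u y)) ` A)"
      by (rule p(5)[OF B])
    also have "ennreal ((\<eta> * norm y0 / r) ^ CARD('m)) * (ennreal (1 / \<alpha>) * hausdorff_outer_measure CARD('m) ((\<lambda>y. p (u y)) ` A))
      = ennreal ((\<eta> * norm y0 / r) ^ CARD('m) * (1 / \<alpha>)) * hausdorff_outer_measure CARD('m) ((\<lambda>y. p (u y)) ` A)"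
      using \<alpha> \<eta> r by (subst ennreal_mult) (auto simp: mult.assoc)
    also have "1 / \<alpha> = norm (g y0) * norm y0 / (g y0 \<bullet> y0)" by (simp add: \<alpha>_eq)
    finally show "(\<lambda>y. p (u y)) ` A \<in> sets borel \<and>
      hausdorff_outer_measure CARD('m) A
        \<le> ennreal ((\<eta> * norm y0 / r) ^ CARD('m) * (norm (g y0) * norm y0 / (g y0 \<bullet> y0)))
           * hausdorff_outer_measure CARD('m) ((\<lambda>y. p (u y)) ` A)"
      using B by simp
  qed (use d(1) p in auto)
qed

section \<open>Comparison of level sets with spheres\<close>

text \<open>A finite subcover and induction over it. One later choice of \<open>P\<close> is an
  estimate whose constant depends on the point; closure under unions makes the constant
  uniform.\<close>

lemma compact_local_to_global:
  assumes "compact L" and loc: "\<And>y. y \<in> L \<Longrightarrow> \<exists>V. open V \<and> y \<in> V \<and> P V"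
    and empty: "P {}" and Un: "\<And>V W. P V \<Longrightarrow> P W \<Longrightarrow> P (V \<union> W)"
  obtains V where "L \<subseteq> V" "P V"
proof -
  obtain F where F: "\<And>y. y \<in> L \<Longrightarrow> open (F y) \<and> y \<in> F y \<and> P (F y)"
    using loc by metis
  obtain C where C: "C \<subseteq> L" "finite C" "L \<subseteq> (\<Union>y\<in>C. F y)"
    using compactE_image[OF \<open>compact L\<close>, of L F] F by blast
  have "P (\<Union>y\<in>C. F y)"
    using C(2,1)
  proof (induction C)
    case (insert y C)
    then show ?case using F[of y] Un[of "F y" "\<Union>y\<in>C. F y"] by simp
  qed (simp add: empty)
  with C(3) show thesis by (rule that)
qed

lemma hausdorff_outer_measure_bounded:
  fixes A :: "'a::euclidean_space set"
  assumes "bounded A"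
  shows "hausdorff_outer_measure DIM('a) A < top"
proof -
  obtain B where B: "0 < B" "\<forall>x\<in>A. norm x \<le> B"
    using assms bounded_pos[of A] by auto
  then have sub: "A \<subseteq> cball 0 B" by auto
  obtain c where c: "\<And>A :: 'a set. A \<in> sets borel \<Longrightarrow>
      hausdorff_outer_measure DIM('a) A = ennreal c * emeasure lborel A"
    using hausdorff_measure_eq_lborel by metis
  have "hausdorff_outer_measure DIM('a) A \<le> ennreal c * emeasure lborel (cball 0 B :: 'a set)"
    using c[of "cball 0 B"] hausdorff_outer_measure_mono[OF sub, of "DIM('a)"] by simp
  also have "\<dots> < top"
    using B(1) by (simp add: emeasure_cball ennreal_mult_less_top)
  finally show ?thesis .
qed

text \<open>The sphere is a level set of \<open>y \<bullet> y\<close>. A chart with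
  \<open>\<eta> = 2\<close> compares a piece of it with a bounded subset of
  \<open>real ^ 'm\<close>, and compactness joins finitely many pieces.\<close>

lemma hausdorff_sphere_finite:
  assumes r: "0 < r" and dim: "DIM('a::euclidean_space) = Suc CARD('m::finite)"
  shows "hausdorff_outer_measure CARD('m) (sphere (0::'a) r) < top"
proof -
  let ?H = "hausdorff_outer_measure CARD('m) :: 'a set \<Rightarrow> ennreal"
  let ?S = "sphere (0::'a) r"
  have S: "?S = {y. (\<lambda>y. y \<bullet> y) y = r\<^sup>2}"
    using r by (auto simp: power2_norm_eq_inner[symmetric] power2_eq_iff_nonneg)
  have G: "GDERIV (\<lambda>y. y \<bullet> y) y :> 2 *\<^sub>R y" for y :: 'a
    unfolding gderiv_def by (auto intro!: derivative_eq_intros simp: inner_commute)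
  obtain V where V: "?S \<subseteq> V" "V \<in> sets borel \<and> ?H (?S \<inter> V) < top"
  proof (rule compact_local_to_global[of ?S])
    fix y0 assume "y0 \<in> ?S"
    then have y0: "0 < (2 *\<^sub>R y0) \<bullet> y0" "norm y0 = r" using r by auto
    obtain \<rho> and p :: "'a \<Rightarrow> real ^ 'm" where p: "0 < \<rho>" "linear p" "\<And>x. norm (p x) \<le> norm x"
      "\<And>A. A \<in> sets borel \<Longrightarrow> A \<subseteq> {y. y \<bullet> y = r\<^sup>2} \<inter> ball y0 \<rho> \<Longrightarrow>
        ?H A \<le> ennreal ((2 * norm y0 / r) ^ CARD('m) * (norm (2 *\<^sub>R y0) * norm y0 / ((2 *\<^sub>R y0) \<bullet> y0)))
             * hausdorff_outer_measure CARD('m) ((\<lambda>y. p ((r / norm y) *\<^sub>R y)) ` A)"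
      by (rule level_set_local_chart[OF G _ y0(1) r, of 2 "r\<^sup>2", where 'm='m])
        (use dim in \<open>auto intro!: continuous_intros\<close>)
    have "norm (p ((r / norm y) *\<^sub>R y)) \<le> r" if "y \<in> ?S" for y
      using p(3)[of "(r / norm y) *\<^sub>R y"] that r by (auto split: if_splits)
    then have "bounded ((\<lambda>y. p ((r / norm y) *\<^sub>R y)) ` (?S \<inter> ball y0 \<rho>))"
      by (intro boundedI[of _ r]) auto
    then have "hausdorff_outer_measure CARD('m) ((\<lambda>y. p ((r / norm y) *\<^sub>R y)) ` (?S \<inter> ball y0 \<rho>)) < top"
      using hausdorff_outer_measure_bounded[where 'a="real ^ 'm"] by simp
    moreover have "?S \<inter> ball y0 \<rho> \<subseteq> {y. y \<bullet> y = r\<^sup>2} \<inter> ball y0 \<rho>" using S by auto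
    ultimately have "?H (?S \<inter> ball y0 \<rho>) < top"
      using p(4)[of "?S \<inter> ball y0 \<rho>"] by (auto intro: le_less_trans simp: ennreal_mult_less_top)
    then show "\<exists>V. open V \<and> y0 \<in> V \<and> V \<in> sets borel \<and> ?H (?S \<inter> V) < top"
      using p(1) by (intro exI[of _ "ball y0 \<rho>"]) auto
  next
    fix V W assume "V \<in> sets borel \<and> ?H (?S \<inter> V) < top" "W \<in> sets borel \<and> ?H (?S \<inter> W) < top"
    moreover have "?H (?S \<inter> (V \<union> W)) \<le> ?H (?S \<inter> V) + ?H (?S \<inter> W)"
      by (simp add: Int_Un_distrib hausdorff_outer_measure_Un)
    ultimately show "V \<union> W \<in> sets borel \<and> ?H (?S \<inter> (V \<union> W)) < top"
      by (auto intro: le_less_trans)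
  qed (auto intro: that)
  then show ?thesis by (simp add: Int_absorb2)
qed

text \<open>The orthogonal projection to a hyperplane is 1-Lipschitz and maps the sphere onto a set
  containing the ball of the same radius, which has positive measure.\<close>

lemma hausdorff_sphere_pos:
  assumes r: "0 < r" and dim: "DIM('a::euclidean_space) = Suc DIM('b::euclidean_space)"
  shows "0 < hausdorff_outer_measure DIM('b) (sphere (0::'a) r)"
proof -
  define w :: 'a where "w = (SOME b. b \<in> Basis)"
  have w: "norm w = 1" unfolding w_def by (intro norm_Basis SOME_Basis)
  then have ww: "w \<bullet> w = 1" by (simp add: norm_eq_1)
  obtain p :: "'a \<Rightarrow> 'b" where p: "linear p" "\<And>x y. p x \<bullet> p y = x \<bullet> y - (x \<bullet> w) * (y \<bullet> w)"
    "\<And>u. \<exists>x. x \<bullet> w = 0 \<and> p x = u"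
    using hyperplane_isometry[OF w dim] by metis
  have p_le: "norm (p x) \<le> norm x" for x
    unfolding norm_le p(2) by simp
  have "ball 0 r \<subseteq> p ` sphere 0 r"
  proof
    fix v :: 'b assume v: "v \<in> ball 0 r"
    obtain x where x: "x \<bullet> w = 0" "p x = v" using p(3) by blast
    have xx: "x \<bullet> x = v \<bullet> v" using p(2)[of x x] x by simp
    have "v \<bullet> v \<le> r\<^sup>2"
      using v r by (simp add: power2_norm_eq_inner[symmetric] power_mono)
    \<comment> \<open>The point of the upper hemisphere over \<open>v\<close>.\<close>
    then have "(x + sqrt (r\<^sup>2 - v \<bullet> v) *\<^sub>R w) \<bullet> (x + sqrt (r\<^sup>2 - v \<bullet> v) *\<^sub>R w) = r\<^sup>2"
      using x(1) xx ww by (simp add: inner_add_left inner_add_right inner_commute)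
    then have "norm (x + sqrt (r\<^sup>2 - v \<bullet> v) *\<^sub>R w) = r"
      using r by (simp add: norm_eq_sqrt_inner)
    moreover have "p w \<bullet> p w = 0" using p(2)[of w w] ww by simp
    then have "p (x + sqrt (r\<^sup>2 - v \<bullet> v) *\<^sub>R w) = v"
      using x by (simp add: linear_add[OF p(1)] linear_scale[OF p(1)])
    ultimately show "v \<in> p ` sphere 0 r" by (metis image_eqI mem_sphere_0)
  qed
  then have "hausdorff_outer_measure DIM('b) (ball (0::'b) r) \<le> hausdorff_outer_measure DIM('b) (p ` sphere 0 r)"
    by (rule hausdorff_outer_measure_mono)
  also have "\<dots> \<le> ennreal (1 ^ DIM('b)) * hausdorff_outer_measure DIM('b) (sphere (0::'a) r)"
    using p_le by (intro hausdorff_outer_measure_lipschitz) (auto simp: dist_norm linear_diff[OF p(1), symmetric])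
  finally have le: "hausdorff_outer_measure DIM('b) (ball (0::'b) r) \<le> hausdorff_outer_measure DIM('b) (sphere (0::'a) r)"
    by simp
  obtain c where c: "0 < c" "\<And>A :: 'b set. A \<in> sets borel \<Longrightarrow>
      hausdorff_outer_measure DIM('b) A = ennreal c * emeasure lborel A"
    using hausdorff_measure_eq_lborel by metis
  have "0 < hausdorff_outer_measure DIM('b) (ball (0::'b) r)"
    using r c by (simp add: emeasure_ball ennreal_mult[symmetric] ennreal_less_zero_iff)
  with le show ?thesis by simp
qed

text \<open>Heuristically, carried to the sphere by \<open>u\<close>, the left-hand integral has at
  \<open>u y0\<close> the density \<open>h 1\<close> defined below, which \<open>norm_le\<close> and
  \<open>radial\<close> put under \<open>1 / (4 * r)\<close>. By \<open>star\<close> the map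
  \<open>u\<close> is injective on the level set, so disjoint pieces have disjoint images, and
  compactness makes the gap uniform.\<close>

lemma nn_integral_level_set_less:
  fixes G :: "'a::euclidean_space \<Rightarrow> real" and g :: "'a \<Rightarrow> 'a"
  assumes G: "\<And>y. GDERIV G y :> g y" and g: "continuous_on UNIV g"
    and r: "0 < r" and dim: "DIM('a) = Suc CARD('m::finite)"
    and L: "compact {y. G y = \<tau>}"
    and norm_le: "\<And>y. G y = \<tau> \<Longrightarrow> 0 < norm y \<and> norm y \<le> r"
    and radial: "\<And>y. G y = \<tau> \<Longrightarrow> 4 * (norm y)\<^sup>2 < g y \<bullet> y"
    and star: "\<And>y s. G y = \<tau> \<Longrightarrow> G (s *\<^sub>R y) = \<tau> \<Longrightarrow> 0 < s \<Longrightarrow> s = 1"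
  shows "(\<integral>\<^sup>+ y \<in> {y. G y = \<tau>}. ennreal (1 / norm (g y)) \<partial>hausdorff_measure CARD('m))
    < ennreal (1 / (4 * r)) * hausdorff_outer_measure CARD('m) (sphere (0::'a) r)"
proof -
  let ?H = "hausdorff_outer_measure CARD('m) :: 'a set \<Rightarrow> ennreal"
  let ?L = "{y. G y = \<tau>}"
  define u where "u y = (r / norm y) *\<^sub>R y" for y :: 'a
  define I where "I A = (\<integral>\<^sup>+ y \<in> A. ennreal (1 / norm (g y)) \<partial>hausdorff_measure CARD('m))" for A
  have [measurable]: "g \<in> borel_measurable borel"
    using g by (rule borel_measurable_continuous_onI)
  have cont_u: "continuous_on ?L u"
    unfolding u_def using norm_le by (intro continuous_intros) auto
  have inj_u: "inj_on u ?L"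
  proof
    fix x y assume xy: "x \<in> ?L" "y \<in> ?L" "u x = u y"
    then have pos: "0 < norm x" "0 < norm y" using norm_le by auto
    have "norm x *\<^sub>R u x = r *\<^sub>R x" "norm x *\<^sub>R u y = (r * (norm x / norm y)) *\<^sub>R y"
      using pos by (auto simp: u_def)
    then have "r *\<^sub>R x = r *\<^sub>R ((norm x / norm y) *\<^sub>R y)" using xy(3) by simp
    then have x: "x = (norm x / norm y) *\<^sub>R y" using r by (metis less_irrefl scaleR_cancel_left)
    then have "norm x / norm y = 1"
      using star[of y "norm x / norm y"] xy pos by simp
    with x show "x = y" by simp
  qed
  have borel_u: "u ` A \<in> sets borel" if "A \<in> sets borel" "A \<subseteq> ?L" for A
    by (rule borel_image_subset_compact[OF L cont_u inj_u that])
  have meas: "(\<lambda>y. ennreal (1 / norm (g y)) * indicator A y) \<in> borel_measurable (hausdorff_measure CARD('m))"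
    if [measurable]: "A \<in> sets borel" for A
    by measurable
  \<comment> \<open>The bound is asked for every Borel subset of a piece, so that overlapping pieces
    can be cut into disjoint ones. Its constant is strictly below the limit, which survives finite
    unions.\<close>
  define P where "P V \<longleftrightarrow> V \<in> sets borel \<and> (\<exists>\<kappa>. 0 \<le> \<kappa> \<and> \<kappa> < 1 / (4 * r) \<and>
    (\<forall>A\<in>sets borel. A \<subseteq> ?L \<inter> V \<longrightarrow> I A \<le> ennreal \<kappa> * ?H (u ` A)))" for V
  obtain V where V: "?L \<subseteq> V" "P V"
  proof (rule compact_local_to_global[OF L, of P])
    fix y0 assume "y0 \<in> ?L"
    then have y0: "0 < norm y0" "norm y0 \<le> r" "4 * (norm y0)\<^sup>2 < g y0 \<bullet> y0"
      using norm_le radial by auto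
    have gy: "0 < g y0 \<bullet> y0" using y0(3) zero_le_power2[of "norm y0"] by linarith
    then have g0: "0 < norm (g y0)" by auto
    \<comment> \<open>The constant of the local chart times the bound
      \<open>\<eta> / norm (g y0)\<close> for the integrand; the norm of \<open>g y0\<close>
      cancels.\<close>
    define h where "h \<eta> = (\<eta> * norm y0 / r) ^ CARD('m) * (norm y0 / (g y0 \<bullet> y0)) * \<eta>" for \<eta>
    have "h 1 < 1 / (4 * r)"
    proof -
      \<comment> \<open>Since \<open>CARD('m)\<close> is at least 1, that is, the ambient dimension
        is at least 2, one factor \<open>norm y0 / r\<close> can be kept; the remaining ones are at
        most 1.\<close>
      have "(norm y0 / r) ^ CARD('m) \<le> (norm y0 / r) ^ 1"
        using y0 r by (intro power_decreasing) auto
      then have "(norm y0 / r) ^ CARD('m) * (norm y0 / (g y0 \<bullet> y0)) \<le> (norm y0 / r) ^ 1 * (norm y0 / (g y0 \<bullet> y0))"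
        using gy by (intro mult_right_mono) auto
      then have "h 1 \<le> (norm y0 / r) * (norm y0 / (g y0 \<bullet> y0))"
        by (simp add: h_def)
      also have "\<dots> = (norm y0)\<^sup>2 / (r * (g y0 \<bullet> y0))" by (simp add: power2_eq_square)
      also have "\<dots> < 1 / (4 * r)"
        using y0(3) gy r by (simp add: field_simps)
      finally show ?thesis .
    qed
    moreover have "(h \<longlongrightarrow> h 1) (at_right 1)"
      unfolding h_def by (intro tendsto_intros) (use r in auto)
    ultimately have "\<forall>\<^sub>F \<eta> in at_right 1. h \<eta> < 1 / (4 * r)"
      by (rule order_tendstoD(2)[rotated])
    then have "\<forall>\<^sub>F \<eta> in at_right 1. h \<eta> < 1 / (4 * r) \<and> 1 < \<eta>"
      using eventually_at_right_less[of "1::real"] by (rule eventually_conj)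
    then obtain \<eta> where \<eta>: "h \<eta> < 1 / (4 * r)" "1 < \<eta>"
      using eventually_happens'[of "at_right (1::real)"] by auto
    obtain \<rho> and p :: "'a \<Rightarrow> real ^ 'm" where p: "0 < \<rho>" "linear p" "\<And>x. norm (p x) \<le> norm x"
      "\<And>A. A \<in> sets borel \<Longrightarrow> A \<subseteq> ?L \<inter> ball y0 \<rho> \<Longrightarrow>
        ?H A \<le> ennreal ((\<eta> * norm y0 / r) ^ CARD('m) * (norm (g y0) * norm y0 / (g y0 \<bullet> y0)))
             * hausdorff_outer_measure CARD('m) ((\<lambda>y. p (u y)) ` A)"
      by (rule level_set_local_chart[OF G g gy r \<eta>(2) dim, of \<tau>, folded u_def]) auto
    have "((\<lambda>y. norm (g y)) \<longlongrightarrow> norm (g y0)) (nhds y0)"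
      using g by (intro tendsto_norm) (simp add: continuous_on_eq_continuous_at continuous_at_imp_continuous_at_within isCont_def tendsto_at_iff_tendsto_nhds)
    moreover have "norm (g y0) / \<eta> < norm (g y0)" using \<eta>(2) g0 by (simp add: field_simps)
    ultimately have "\<forall>\<^sub>F y in nhds y0. norm (g y0) / \<eta> < norm (g y)"
      by (rule order_tendstoD(1))
    then obtain e where e: "0 < e" "\<And>y. dist y y0 < e \<Longrightarrow> norm (g y0) / \<eta> < norm (g y)"
      unfolding eventually_nhds_metric by blast
    have "P (ball y0 (min \<rho> e))"
      unfolding P_def
    proof (intro conjI exI[of _ "h \<eta>"] ballI impI)
      show "0 \<le> h \<eta>" using \<eta> r gy by (simp add: h_def)
      fix A :: "'a set" assume A: "A \<in> sets borel" "A \<subseteq> ?L \<inter> ball y0 (min \<rho> e)"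
      have "I A \<le> (\<integral>\<^sup>+ y. ennreal (\<eta> / norm (g y0)) * indicator A y \<partial>hausdorff_measure CARD('m))"
        unfolding I_def
      proof (intro nn_integral_mono)
        fix y
        have "1 / norm (g y) \<le> \<eta> / norm (g y0)" if "y \<in> A"
        proof -
          have "dist y y0 < e" using A(2) that by (auto simp: dist_commute)
          then have "norm (g y0) / \<eta> < norm (g y)" by (rule e(2))
          moreover then have "0 < norm (g y)" using g0 \<eta>(2) by (meson divide_pos_pos less_trans zero_less_one)
          ultimately show ?thesis using g0 \<eta>(2) by (simp add: field_simps)
        qed
        then show "ennreal (1 / norm (g y)) * indicator A y \<le> ennreal (\<eta> / norm (g y0)) * indicator A y"
          by (auto simp: indicator_def intro!: ennreal_leI)
      qed
      also have "\<dots> = ennreal (\<eta> / norm (g y0)) * ?H A"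
        using A(1) by (simp add: nn_integral_cmult_indicator emeasure_hausdorff_measure)
      also have "?H A \<le> ennreal ((\<eta> * norm y0 / r) ^ CARD('m) * (norm (g y0) * norm y0 / (g y0 \<bullet> y0)))
             * hausdorff_outer_measure CARD('m) ((\<lambda>y. p (u y)) ` A)"
        using A by (intro p(4)) auto
      \<comment> \<open>\<open>p\<close> does not increase distances, so the estimate passes from
        the flat chart, which depends on \<open>y0\<close>, to the spherical image, which does
        not.\<close>
      also have "hausdorff_outer_measure CARD('m) ((\<lambda>y. p (u y)) ` A) \<le> ?H (u ` A)"
        using hausdorff_outer_measure_lipschitz[of 1 "u ` A" p "CARD('m)"] p(3)
        by (simp add: dist_norm linear_diff[OF p(2), symmetric] image_image)
      also have "ennreal (\<eta> / norm (g y0)) * (ennreal ((\<eta> * norm y0 / r) ^ CARD('m) * (norm (g y0) * norm y0 / (g y0 \<bullet> y0))) * ?H (u ` A))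
        = ennreal (h \<eta>) * ?H (u ` A)"
      proof -
        have "\<eta> / norm (g y0) * ((\<eta> * norm y0 / r) ^ CARD('m) * (norm (g y0) * norm y0 / (g y0 \<bullet> y0))) = h \<eta>"
          using g0 by (simp add: h_def)
        then show ?thesis
          using \<eta>(2) r gy by (simp add: mult.assoc[symmetric] ennreal_mult[symmetric])
      qed
      finally show "I A \<le> ennreal (h \<eta>) * ?H (u ` A)"
        by (simp add: mult_left_mono)
    qed (use \<eta> in auto)
    then show "\<exists>V. open V \<and> y0 \<in> V \<and> P V"
      using p(1) e(1) by (intro exI[of _ "ball y0 (min \<rho> e)"]) auto
  next
    show "P {}" unfolding P_def using r by (auto simp: I_def intro!: exI[of _ 0])
  next
    fix V W assume PV: "P V" and PW: "P W"
    obtain \<kappa> where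
      \<kappa>: "V \<in> sets borel" "0 \<le> \<kappa>" "\<kappa> < 1 / (4 * r)" "\<And>A. A \<in> sets borel \<Longrightarrow> A \<subseteq> ?L \<inter> V \<Longrightarrow> I A \<le> ennreal \<kappa> * ?H (u ` A)"
      using PV unfolding P_def by blast
    obtain \<kappa>' where
      \<kappa>': "W \<in> sets borel" "0 \<le> \<kappa>'" "\<kappa>' < 1 / (4 * r)" "\<And>A. A \<in> sets borel \<Longrightarrow> A \<subseteq> ?L \<inter> W \<Longrightarrow> I A \<le> ennreal \<kappa>' * ?H (u ` A)"
      using PW unfolding P_def by blast
    define K where "K = max \<kappa> \<kappa>'"
    have "I A \<le> ennreal K * ?H (u ` A)" if A: "A \<in> sets borel" "A \<subseteq> ?L \<inter> (V \<union> W)" for A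
    proof -
      have sets: "A \<inter> V \<in> sets borel" "A - V \<in> sets borel" using A(1) \<kappa>(1) by auto
      have "I A = I ((A \<inter> V) \<union> (A - V))" by (simp add: Int_Diff_Un)
      also have "\<dots> = I (A \<inter> V) + I (A - V)"
        unfolding I_def nn_integral_add[OF meas[OF sets(1)] meas[OF sets(2)], symmetric]
        by (rule nn_integral_cong) (auto simp: indicator_def)
      also have "\<dots> \<le> ennreal \<kappa> * ?H (u ` (A \<inter> V)) + ennreal \<kappa>' * ?H (u ` (A - V))"
        using A sets by (intro add_mono \<kappa>(4) \<kappa>'(4)) auto
      also have "\<dots> \<le> ennreal K * ?H (u ` (A \<inter> V)) + ennreal K * ?H (u ` (A - V))"
        by (intro add_mono mult_right_mono ennreal_leI) (auto simp: K_def)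
      also have "\<dots> = ennreal K * (?H (u ` (A \<inter> V)) + ?H (u ` (A - V)))"
        by (simp add: distrib_left)
      \<comment> \<open>Injectivity of \<open>u\<close> on the level set makes the two images
        disjoint, and both are Borel, so the outer measure is additive on them.\<close>
      also have "?H (u ` (A \<inter> V)) + ?H (u ` (A - V)) = ?H (u ` (A \<inter> V) \<union> u ` (A - V))"
      proof -
        have b: "u ` (A \<inter> V) \<in> sets borel" "u ` (A - V) \<in> sets borel"
          using A by (auto intro!: borel_u sets)
        moreover have "u ` (A \<inter> V) \<inter> u ` (A - V) = {}"
          using inj_on_image_Int[OF inj_u, of "A \<inter> V" "A - V"] A(2) by blast
        ultimately show ?thesis
          using plus_emeasure[of "u ` (A \<inter> V)" "hausdorff_measure CARD('m)" "u ` (A - V)"]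
          by (simp add: emeasure_hausdorff_measure)
      qed
      also have "u ` (A \<inter> V) \<union> u ` (A - V) = u ` A" by blast
      finally show ?thesis .
    qed
    then show "P (V \<union> W)"
      unfolding P_def using \<kappa>(1-3) \<kappa>'(1-3) by (intro conjI exI[of _ K]) (auto simp: K_def)
  qed
  obtain \<kappa> where \<kappa>: "0 \<le> \<kappa>" "\<kappa> < 1 / (4 * r)"
    "\<And>A. A \<in> sets borel \<Longrightarrow> A \<subseteq> ?L \<inter> V \<Longrightarrow> I A \<le> ennreal \<kappa> * ?H (u ` A)"
    using V(2) unfolding P_def by blast
  have "I ?L \<le> ennreal \<kappa> * ?H (u ` ?L)"
    using V(1) L by (intro \<kappa>(3)) (auto intro: borel_compact)
  also have "\<dots> \<le> ennreal \<kappa> * ?H (sphere 0 r)"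
    using norm_le r by (intro mult_left_mono hausdorff_outer_measure_mono) (auto simp: u_def)
  also have "\<dots> < ennreal (1 / (4 * r)) * ?H (sphere 0 r)"
  proof -
    \<comment> \<open>The strict inequality between the constants survives multiplication because
      the factor is positive and finite.\<close>
    have "0 < ?H (sphere 0 r)"
      using hausdorff_sphere_pos[OF r, where 'a='a and 'b="real ^ 'm"] dim by simp
    moreover have "?H (sphere 0 r) < top" by (rule hausdorff_sphere_finite[OF r dim])
    ultimately obtain h where "?H (sphere 0 r) = ennreal h" "0 < h"
      by (cases "?H (sphere 0 r)" rule: ennreal_cases) auto
    then show ?thesis
      using \<kappa> r by (simp add: ennreal_mult[symmetric] ennreal_less_iff del: times_divide_eq_left)
  qed
  finally show ?thesis unfolding I_def .
qed

section \<open>Self-convolutions of projection measures\<close>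

lemma gradient_eqI:
  assumes "GDERIV f x :> D"
  shows "gradient f x = D"
  unfolding gradient_def
proof (rule the_equality, rule assms)
  fix D' assume "GDERIV f x :> D'"
  with assms have "(\<lambda>h. h \<bullet> D') = (\<lambda>h. h \<bullet> D)"
    unfolding gderiv_def by (rule has_derivative_unique[rotated])
  then show "D' = D" by (metis inner_commute vector_eq_ldot)
qed

lemma GDERIV_gradient:
  assumes "f differentiable (at x)"
  shows "GDERIV f x :> gradient f x"
proof -
  obtain f' where f': "(f has_derivative f') (at x)"
    using assms by (auto simp: differentiable_def)
  have "f' h = h \<bullet> (\<Sum>b\<in>Basis. f' b *\<^sub>R b)" for h
  proof -
    have "f' h = f' (\<Sum>b\<in>Basis. (h \<bullet> b) *\<^sub>R b)" by (simp add: euclidean_representation)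
    also have "\<dots> = h \<bullet> (\<Sum>b\<in>Basis. f' b *\<^sub>R b)"
      using has_derivative_linear[OF f']
      by (simp add: linear_sum linear_scale inner_sum_right mult.commute)
    finally show ?thesis .
  qed
  then have "f' = (\<lambda>h. h \<bullet> (\<Sum>b\<in>Basis. f' b *\<^sub>R b))" by blast
  with f' have "GDERIV f x :> (\<Sum>b\<in>Basis. f' b *\<^sub>R b)"
    unfolding gderiv_def by simp
  then show ?thesis using gradient_eqI by metis
qed

lemma GDERIV_reflect_translate:
  assumes "\<And>x. GDERIV f x :> g x"
  shows "GDERIV (\<lambda>y. f (c - y) + f (c + y)) y :> g (c + y) - g (c - y)"
proof -
  have "((\<lambda>y. f (c - y)) has_derivative (\<lambda>h. (- h) \<bullet> g (c - y))) (at y)"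
    by (rule has_derivative_compose[of "\<lambda>y. c - y" "uminus" _ _ f])
      (use assms in \<open>auto intro!: derivative_eq_intros simp: gderiv_def\<close>)
  moreover have "((\<lambda>y. f (c + y)) has_derivative (\<lambda>h. h \<bullet> g (c + y))) (at y)"
    by (rule has_derivative_compose[of "\<lambda>y. c + y" "\<lambda>h. h" _ _ f])
      (use assms in \<open>auto intro!: derivative_eq_intros simp: gderiv_def\<close>)
  ultimately have "((\<lambda>y. f (c - y) + f (c + y)) has_derivative (\<lambda>h. (- h) \<bullet> g (c - y) + h \<bullet> g (c + y))) (at y)"
    by (rule has_derivative_add)
  then show ?thesis by (simp add: gderiv_def inner_diff_right)
qed

lemma GDERIV_norm_square: "GDERIV (\<lambda>y. (norm y)\<^sup>2) y :> 2 *\<^sub>R y"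
  for y :: "'a::real_inner"
proof -
  have "((\<lambda>y. y \<bullet> y) has_derivative (\<lambda>h. y \<bullet> h + h \<bullet> y)) (at y)"
    by (rule has_derivative_inner[OF has_derivative_ident has_derivative_ident])
  then show ?thesis
    by (simp add: gderiv_def power2_norm_eq_inner inner_commute)
qed

text \<open>Parallelogram law: the terms linear in \<open>y\<close> cancel, so for the paraboloid
  the level sets are spheres about the origin whatever \<open>c\<close> is.\<close>

lemma norm_square_diff_add:
  fixes c y :: "'a::real_inner"
  shows "(norm (c - y))\<^sup>2 + (norm (c + y))\<^sup>2 = 2 * (norm c)\<^sup>2 + 2 * (norm y)\<^sup>2"
  by (simp add: power2_norm_eq_inner algebra_simps inner_commute[of y c])

lemma delta_integral_eq:
  fixes F :: "'a::euclidean_space \<Rightarrow> real"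
  assumes "\<And>y. GDERIV F y :> g y"
  shows "delta_integral F \<tau> =
    (\<integral>\<^sup>+ y \<in> {y. F y = \<tau>}. ennreal (1 / norm (g y)) \<partial>hausdorff_measure (DIM('a) - 1))"
  unfolding delta_integral_def using gradient_eqI[OF assms] by simp

text \<open>On the sphere the gradient \<open>4 *\<^sub>R y\<close> has constant norm
  \<open>4 * r\<close>. The area of the sphere stays unevaluated, as in the bound of
  \<open>nn_integral_level_set_less\<close>.\<close>

lemma convolution_density_norm_square:
  fixes \<xi> :: "'a::euclidean_space"
  assumes "0 < \<tau>"
  defines "r \<equiv> sqrt (\<tau> / 2)"
  shows "convolution_density (\<lambda>y. (norm y)\<^sup>2) \<xi> (2 * (norm (\<xi> /\<^sub>R 2))\<^sup>2 + \<tau>)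
    = ennreal (1 / (4 * r)) * hausdorff_outer_measure (DIM('a) - 1) (sphere (0::'a) r)"
proof -
  define c where "c = \<xi> /\<^sub>R 2"
  let ?F = "\<lambda>y. (norm (c - y))\<^sup>2 + (norm (c + y))\<^sup>2"
  have r: "0 < r" "r\<^sup>2 = \<tau> / 2" using assms by (auto simp: r_def)
  have "2 *\<^sub>R (c + y) - 2 *\<^sub>R (c - y) = 4 *\<^sub>R y" for y
    by (simp add: algebra_simps flip: scaleR_2)
  then have F: "GDERIV ?F y :> 4 *\<^sub>R y" for y
    using GDERIV_reflect_translate[OF GDERIV_norm_square, of c y] by metis
  have "y \<in> {y. ?F y = 2 * (norm c)\<^sup>2 + \<tau>} \<longleftrightarrow> y \<in> sphere 0 r" for y
  proof -
    have "y \<in> {y. ?F y = 2 * (norm c)\<^sup>2 + \<tau>} \<longleftrightarrow> (norm y)\<^sup>2 = r\<^sup>2"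
      unfolding norm_square_diff_add r(2) by auto
    also have "\<dots> \<longleftrightarrow> y \<in> sphere 0 r"
      using r(1) by (simp add: power2_eq_iff_nonneg)
    finally show ?thesis .
  qed
  then have level: "{y. ?F y = 2 * (norm c)\<^sup>2 + \<tau>} = sphere 0 r" by blast
  have "convolution_density (\<lambda>y. (norm y)\<^sup>2) \<xi> (2 * (norm (\<xi> /\<^sub>R 2))\<^sup>2 + \<tau>)
    = (\<integral>\<^sup>+ y \<in> sphere (0::'a) r. ennreal (1 / norm (4 *\<^sub>R y)) \<partial>hausdorff_measure (DIM('a) - 1))"
    unfolding convolution_density_def c_def[symmetric] delta_integral_eq[OF F] level by (rule refl)
  also have "\<dots> = (\<integral>\<^sup>+ y. ennreal (1 / (4 * r)) * indicator (sphere (0::'a) r) y \<partial>hausdorff_measure (DIM('a) - 1))"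
    by (intro nn_integral_cong) (auto simp: indicator_def)
  also have "\<dots> = ennreal (1 / (4 * r)) * hausdorff_outer_measure (DIM('a) - 1) (sphere (0::'a) r)"
    by (simp add: nn_integral_cmult_indicator emeasure_hausdorff_measure)
  finally show ?thesis .
qed

section \<open>Strict convexity and the comparison of densities\<close>

lemma convex_on_norm_square: "convex_on UNIV (\<lambda>y :: 'a::real_inner. (norm y)\<^sup>2)"
proof (rule convex_onI)
  fix t :: real and x y :: 'a assume t: "0 < t" "t < 1"
  have "(1 - t) * (norm x)\<^sup>2 + t * (norm y)\<^sup>2 - (norm ((1 - t) *\<^sub>R x + t *\<^sub>R y))\<^sup>2
    = t * (1 - t) * (norm (x - y))\<^sup>2"
    by (simp add: power2_norm_eq_inner algebra_simps inner_commute[of y x])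
  moreover have "0 \<le> t * (1 - t) * (norm (x - y))\<^sup>2" using t by simp
  ultimately show "(norm ((1 - t) *\<^sub>R x + t *\<^sub>R y))\<^sup>2 \<le> (1 - t) * (norm x)\<^sup>2 + t * (norm y)\<^sup>2"
    by linarith
qed simp

lemma strictly_convex_onD:
  assumes "strictly_convex_on S f" "x \<in> S" "y \<in> S" "x \<noteq> y" "0 < u" "0 < v" "u + v = 1"
  shows "f (u *\<^sub>R x + v *\<^sub>R y) < u * f x + v * f y"
  using assms unfolding strictly_convex_on_def by blast

lemma strictly_convex_on_imp_convex_on:
  assumes "strictly_convex_on S f"
  shows "convex_on S f"
proof (rule convex_onI)
  fix t :: real and x y assume "0 < t" "t < 1" "x \<in> S" "y \<in> S"
  then show "f ((1 - t) *\<^sub>R x + t *\<^sub>R y) \<le> (1 - t) * f x + t * f y"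
    using strictly_convex_onD[OF assms, of x y "1 - t" t]
    by (cases "x = y") (auto simp: algebra_simps less_imp_le)
qed (use assms in \<open>simp add: strictly_convex_on_def\<close>)

text \<open>The hypotheses of \<open>nn_integral_level_set_less\<close> are checked for the level
  set of \<open>F\<close> at \<open>t\<close>. Both densities are taken at the same height
  \<open>\<tau>\<close> above the value at \<open>y = 0\<close>, so that \<open>\<Phi>\<close>
  enters through \<open>\<Phi> y - \<Phi> 0\<close>.\<close>

lemma convolution_density_less:
  fixes \<phi> :: "'a::euclidean_space \<Rightarrow> real"
  assumes dim: "DIM('a) = Suc CARD('m::finite)"
    and diff: "\<And>x. \<phi> differentiable (at x)"
    and C1: "continuous_on UNIV (gradient \<phi>)"
    and sc: "strictly_convex_on UNIV \<phi>" and \<tau>: "0 < \<tau>"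
  shows "convolution_density (\<lambda>y. (norm y)\<^sup>2 + \<phi> y) \<xi> (2 * ((norm (\<xi> /\<^sub>R 2))\<^sup>2 + \<phi> (\<xi> /\<^sub>R 2)) + \<tau>)
    < convolution_density (\<lambda>y. (norm y)\<^sup>2) \<xi> (2 * (norm (\<xi> /\<^sub>R 2))\<^sup>2 + \<tau>)"
proof -
  define c where "c = \<xi> /\<^sub>R 2"
  define r where "r = sqrt (\<tau> / 2)"
  have r: "0 < r" "r\<^sup>2 = \<tau> / 2" using \<tau> by (auto simp: r_def)
  define \<psi> where "\<psi> = (\<lambda>y. (norm y)\<^sup>2 + \<phi> y)"
  define F where "F y = \<psi> (c - y) + \<psi> (c + y)" for y
  define g where "g y = (2 *\<^sub>R (c + y) + gradient \<phi> (c + y)) - (2 *\<^sub>R (c - y) + gradient \<phi> (c - y))" for y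
  define \<Phi> where "\<Phi> y = \<phi> (c - y) + \<phi> (c + y)" for y
  define t where "t = 2 * \<psi> c + \<tau>"
  have F_abs: "F = (\<lambda>y. \<psi> (c - y) + \<psi> (c + y))" by (simp add: F_def fun_eq_iff)
  note D\<phi> = GDERIV_gradient[OF diff]
  have F: "GDERIV F y :> g y" for y
    unfolding F_def g_def \<psi>_def
    using GDERIV_reflect_translate[OF GDERIV_add[OF GDERIV_norm_square D\<phi>], of c y] .
  have \<Phi>: "GDERIV \<Phi> y :> gradient \<phi> (c + y) - gradient \<phi> (c - y)" for y
    unfolding \<Phi>_def using GDERIV_reflect_translate[OF D\<phi>] .
  have g: "continuous_on UNIV g"
    unfolding g_def by (intro continuous_intros continuous_on_compose2[OF C1]) auto
  have "F y = 2 * (norm c)\<^sup>2 + 2 * (norm y)\<^sup>2 + \<Phi> y" for y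
    using norm_square_diff_add[of c y] by (simp add: F_def \<psi>_def \<Phi>_def)
  then have level: "F y = t \<longleftrightarrow> 2 * (norm y)\<^sup>2 + (\<Phi> y - \<Phi> 0) = \<tau>" for y
    by (auto simp: t_def \<psi>_def \<Phi>_def)
  \<comment> \<open>\<open>c\<close> is the midpoint of the distinct points \<open>c - y\<close> and
    \<open>c + y\<close>, so strict convexity makes 0 the unique minimum of
    \<open>\<Phi>\<close>.\<close>
  have \<Phi>_pos: "\<Phi> 0 < \<Phi> y" if "y \<noteq> 0" for y
  proof -
    have "c - y \<noteq> c + y"
    proof
      assume eq: "c - y = c + y"
      have "(c + y) - (c - y) = 2 *\<^sub>R y" by (simp add: scaleR_2)
      then have "2 *\<^sub>R y = 0" unfolding eq by simp
      with that show False by simp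
    qed
    then have "\<phi> ((1/2) *\<^sub>R (c - y) + (1/2) *\<^sub>R (c + y)) < 1/2 * \<phi> (c - y) + 1/2 * \<phi> (c + y)"
      by (intro strictly_convex_onD[OF sc]) auto
    moreover have "(1/2) *\<^sub>R (c - y) + (1/2) *\<^sub>R (c + y) = c"
      by (simp add: algebra_simps flip: scaleR_add_left)
    ultimately show ?thesis by (simp add: \<Phi>_def)
  qed
  have conv: "\<Phi> (s *\<^sub>R y) - \<Phi> 0 \<le> s * (\<Phi> y - \<Phi> 0)" if "0 < s" "s < 1" for s y
  proof -
    have *: "\<phi> (s *\<^sub>R x + (1 - s) *\<^sub>R c) \<le> s * \<phi> x + (1 - s) * \<phi> c" for x
      using strictly_convex_on_imp_convex_on[OF sc] that by (simp add: convex_on_def)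
    have "s *\<^sub>R (c - y) + (1 - s) *\<^sub>R c = c - s *\<^sub>R y" "s *\<^sub>R (c + y) + (1 - s) *\<^sub>R c = c + s *\<^sub>R y"
      by (simp_all add: algebra_simps)
    then show ?thesis
      using *[of "c - y"] *[of "c + y"] by (simp add: \<Phi>_def algebra_simps)
  qed
  \<comment> \<open>Shrinking \<open>y\<close> by \<open>s < 1\<close> multiplies the height above
    the minimum, which is \<open>\<tau>\<close> on the level set, by at most \<open>s\<close>. Hence
    a ray meets the level set at most once.\<close>
  have star_less: False if "F y = t" "F (s *\<^sub>R y) = t" "0 < s" "s < 1" for s y
  proof -
    have "s\<^sup>2 \<le> s" using that by (simp add: power2_eq_square mult_left_le_one_le)
    then have "s\<^sup>2 * (norm y)\<^sup>2 \<le> s * (norm y)\<^sup>2" by (intro mult_right_mono) auto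
    then have "2 * (norm (s *\<^sub>R y))\<^sup>2 + (\<Phi> (s *\<^sub>R y) - \<Phi> 0) \<le> s * (2 * (norm y)\<^sup>2 + (\<Phi> y - \<Phi> 0))"
      using conv[OF that(3,4), of y] by (simp add: power_mult_distrib distrib_left)
    then have "\<tau> \<le> s * \<tau>" using that level by simp
    then show False using \<tau> that(4) by simp
  qed
  have norm_le: "0 < norm y \<and> norm y \<le> r" if "F y = t" for y
  proof -
    have eq: "2 * (norm y)\<^sup>2 + (\<Phi> y - \<Phi> 0) = \<tau>" using that level by simp
    then have "y \<noteq> 0" using \<tau> by auto
    moreover have "(norm y)\<^sup>2 \<le> r\<^sup>2"
      using \<Phi>_pos[OF \<open>y \<noteq> 0\<close>] eq r(2) by simp
    ultimately show ?thesis using r(1) by (simp add: power2_le_iff_abs_le)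
  qed
  have F_cont: "continuous_on UNIV F"
    using F by (auto simp: gderiv_def continuous_on_eq_continuous_at intro: has_derivative_continuous)
  have L: "compact {y. F y = t}"
  proof -
    have "closed (F -` {t})"
      using F_cont by (intro continuous_closed_vimage) (auto simp: continuous_on_eq_continuous_at)
    moreover have "bounded {y. F y = t}"
      using norm_le by (intro boundedI[of _ r]) auto
    ultimately show ?thesis by (simp add: compact_eq_bounded_closed vimage_def)
  qed
  \<comment> \<open>\<open>g y \<bullet> y\<close> is \<open>4 * (norm y)\<^sup>2\<close> plus the
    derivative at 1 of \<open>k s = \<Phi> (s *\<^sub>R y)\<close>. By convexity the tangent of
    \<open>k\<close> at 1 does not exceed \<open>k\<close> at 0, so this derivative is at least
    \<open>k 1 - k 0\<close>, which is positive.\<close>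
  have radial: "4 * (norm y)\<^sup>2 < g y \<bullet> y" if "F y = t" for y
  proof -
    have "y \<noteq> 0" using norm_le[OF that] by auto
    define k where "k s = \<Phi> (s *\<^sub>R y)" for s :: real
    have k': "(k has_field_derivative (gradient \<phi> (c + y) - gradient \<phi> (c - y)) \<bullet> y) (at 1)"
    proof -
      have "(k has_derivative (\<lambda>h. (h *\<^sub>R y) \<bullet> (gradient \<phi> (c + y) - gradient \<phi> (c - y)))) (at 1)"
        unfolding k_def
        by (rule has_derivative_compose[of "\<lambda>s. s *\<^sub>R y" "\<lambda>h. h *\<^sub>R y" _ _ \<Phi>])
          (use \<Phi>[of y] in \<open>auto intro!: derivative_eq_intros simp: gderiv_def\<close>)
      then show ?thesis
        by (simp add: has_field_derivative_def inner_commute mult.commute[of _ "_ \<bullet> _"])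
    qed
    have "convex_on UNIV k"
    proof (rule convex_onI)
      fix s x z :: real assume s: "0 < s" "s < 1"
      have *: "\<phi> ((1 - s) *\<^sub>R p + s *\<^sub>R q) \<le> (1 - s) * \<phi> p + s * \<phi> q" for p q
        using strictly_convex_on_imp_convex_on[OF sc] s by (simp add: convex_on_def)
      have "c - ((1 - s) *\<^sub>R x + s *\<^sub>R z) *\<^sub>R y = (1 - s) *\<^sub>R (c - x *\<^sub>R y) + s *\<^sub>R (c - z *\<^sub>R y)"
        "c + ((1 - s) *\<^sub>R x + s *\<^sub>R z) *\<^sub>R y = (1 - s) *\<^sub>R (c + x *\<^sub>R y) + s *\<^sub>R (c + z *\<^sub>R y)"
        by (simp_all add: algebra_simps)
      then show "k ((1 - s) *\<^sub>R x + s *\<^sub>R z) \<le> (1 - s) * k x + s * k z"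
        using *[of "c - x *\<^sub>R y" "c - z *\<^sub>R y"] *[of "c + x *\<^sub>R y" "c + z *\<^sub>R y"]
        unfolding k_def \<Phi>_def by (simp add: distrib_left)
    qed simp
    then have "k 0 - k 1 \<ge> (gradient \<phi> (c + y) - gradient \<phi> (c - y)) \<bullet> y * (0 - 1)"
      using k' by (intro convex_on_imp_above_tangent[of UNIV k]) auto
    then have "0 < (gradient \<phi> (c + y) - gradient \<phi> (c - y)) \<bullet> y"
      using \<Phi>_pos[OF \<open>y \<noteq> 0\<close>] by (simp add: k_def)
    moreover have "g y = 4 *\<^sub>R y + (gradient \<phi> (c + y) - gradient \<phi> (c - y))"
      by (simp add: g_def algebra_simps flip: scaleR_2)
    ultimately show ?thesis
      by (simp add: inner_add_left power2_norm_eq_inner)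
  qed
  have star: "s = 1" if "F y = t" "F (s *\<^sub>R y) = t" "0 < s" for y s
  proof (cases s "1::real" rule: linorder_cases)
    case less
    then show ?thesis using star_less that by blast
  next
    case greater
    \<comment> \<open>For \<open>s > 1\<close> the two points swap roles.\<close>
    then have "F ((1 / s) *\<^sub>R (s *\<^sub>R y)) = t" using that by simp
    then show ?thesis using star_less[OF that(2), of "1 / s"] greater by simp
  qed
  have "convolution_density \<psi> \<xi> t
    = (\<integral>\<^sup>+ y \<in> {y. F y = t}. ennreal (1 / norm (g y)) \<partial>hausdorff_measure CARD('m))"
    unfolding convolution_density_def c_def[symmetric] F_abs[symmetric]
    using delta_integral_eq[OF F, of t] dim by simp
  also have "\<dots> < ennreal (1 / (4 * r)) * hausdorff_outer_measure CARD('m) (sphere (0::'a) r)"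
    by (rule nn_integral_level_set_less[OF F g r(1) dim L norm_le radial star])
  also have "\<dots> = convolution_density (\<lambda>y. (norm y)\<^sup>2) \<xi> (2 * (norm (\<xi> /\<^sub>R 2))\<^sup>2 + \<tau>)"
    using convolution_density_norm_square[OF \<tau>, of \<xi>] dim by (simp add: r_def)
  finally show ?thesis by (simp add: t_def \<psi>_def c_def)
qed

section \<open>The support of the self-convolution\<close>

lemma sigma_finite_projection_measure:
  fixes \<Psi> :: "'a::euclidean_space \<Rightarrow> real"
  assumes [measurable]: "\<Psi> \<in> borel_measurable borel"
  shows "sigma_finite_measure (projection_measure \<Psi>)"
proof
  \<comment> \<open>The measure of a cylinder over a ball is the volume of the ball.
    Sigma-finiteness allows the product of two projection measures to be written as one push-forward
    below.\<close>
  let ?A = "\<lambda>n::nat. cball (0::'a) (real n) \<times> (UNIV :: real set)"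
  have "emeasure (projection_measure \<Psi>) (?A n) \<noteq> \<infinity>" for n
  proof -
    have "emeasure (projection_measure \<Psi>) (?A n)
      = emeasure lborel ((\<lambda>y. (y, \<Psi> y)) -` ?A n \<inter> space lborel)"
      unfolding projection_measure_def
      by (intro emeasure_distr) (auto intro!: borel_closed closed_Times simp: borel_prod[symmetric])
    also have "(\<lambda>y. (y, \<Psi> y)) -` ?A n \<inter> space lborel = cball 0 (real n)" by auto
    finally show ?thesis by (simp add: emeasure_cball)
  qed
  moreover have "x \<in> (\<Union>n. ?A n)" for x :: "'a \<times> real"
    using real_arch_simple[of "norm (fst x)"] by (cases x) auto
  moreover have "?A n \<in> sets borel" for n
    by (intro borel_closed closed_Times) auto
  ultimately show "\<exists>A. countable A \<and> A \<subseteq> sets (projection_measure \<Psi>) \<and>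
      \<Union> A = space (projection_measure \<Psi>) \<and> (\<forall>a\<in>A. emeasure (projection_measure \<Psi>) a \<noteq> \<infinity>)"
    by (intro exI[of _ "range ?A"]) (auto simp: projection_measure_def)
qed

text \<open>The convolution is the image of Lebesgue measure on pairs under the map sending
  \<open>(x, y)\<close> to \<open>(x + y, \<Psi> x + \<Psi> y)\<close>. Midpoint convexity keeps the
  values of this map out of the open set \<open>U\<close> below the graph, so \<open>U\<close> is
  null and misses the support.\<close>

lemma measure_support_projection_convolution:
  fixes \<Psi> :: "'a::ordered_euclidean_space \<Rightarrow> real"
  assumes cont: "continuous_on UNIV \<Psi>" and convex: "convex_on UNIV \<Psi>"
    and supp: "(\<xi>, t) \<in> measure_support (projection_measure \<Psi> \<star> projection_measure \<Psi>)"
  shows "2 * \<Psi> (\<xi> /\<^sub>R 2) \<le> t"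
proof (rule ccontr)
  let ?\<sigma> = "projection_measure \<Psi>"
  define U where "U = {p. snd p < 2 * \<Psi> (fst p /\<^sub>R 2)}"
  assume "\<not> ?thesis"
  then have "(\<xi>, t) \<in> U" by (simp add: U_def)
  have "open U"
    unfolding U_def
    by (intro open_Collect_less continuous_intros continuous_on_compose2[OF cont]) auto
  then have [measurable]: "U \<in> sets borel" by simp
  have [measurable]: "\<Psi> \<in> borel_measurable borel"
    using cont by (rule borel_measurable_continuous_onI)
  have f [measurable]: "(\<lambda>y. (y, \<Psi> y)) \<in> borel \<rightarrow>\<^sub>M borel"
    unfolding borel_prod[symmetric] by measurable
  have "?\<sigma> \<Otimes>\<^sub>M ?\<sigma> = distr (lborel \<Otimes>\<^sub>M lborel) (borel \<Otimes>\<^sub>M borel) (\<lambda>(x, y). ((x, \<Psi> x), (y, \<Psi> y)))"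
    unfolding projection_measure_def
    using f sigma_finite_projection_measure[of \<Psi>, unfolded projection_measure_def]
    by (intro pair_measure_distr) auto
  then have "?\<sigma> \<star> ?\<sigma> = distr (distr (lborel \<Otimes>\<^sub>M lborel) (borel \<Otimes>\<^sub>M borel) (\<lambda>(x, y). ((x, \<Psi> x), (y, \<Psi> y)))) borel (\<lambda>(x, y). x + y)"
    by (simp add: convolution_def)
  also have "\<dots> = distr (lborel \<Otimes>\<^sub>M lborel) borel (\<lambda>(x, y). (x + y, \<Psi> x + \<Psi> y))"
    by (subst distr_distr) (auto simp: comp_def split_def)
  moreover have add: "(\<lambda>(x, y). (x + y, \<Psi> x + \<Psi> y)) \<in> lborel \<Otimes>\<^sub>M lborel \<rightarrow>\<^sub>M borel"
    unfolding borel_prod[symmetric] by measurable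
  ultimately have "emeasure (?\<sigma> \<star> ?\<sigma>) U
    = emeasure (lborel \<Otimes>\<^sub>M lborel) ((\<lambda>(x, y). (x + y, \<Psi> x + \<Psi> y)) -` U \<inter> space (lborel \<Otimes>\<^sub>M lborel))"
    using add by (simp add: emeasure_distr)
  also have "(\<lambda>(x, y). (x + y, \<Psi> x + \<Psi> y)) -` U = {}"
  proof -
    have "2 * \<Psi> ((x + y) /\<^sub>R 2) \<le> \<Psi> x + \<Psi> y" for x y
    proof -
      have "\<Psi> ((1/2) *\<^sub>R x + (1/2) *\<^sub>R y) \<le> 1/2 * \<Psi> x + 1/2 * \<Psi> y"
        using convex_onD[OF convex, of "1/2" x y] by simp
      moreover have "(x + y) /\<^sub>R 2 = (1/2) *\<^sub>R x + (1/2) *\<^sub>R y"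
        by (simp add: scaleR_add_right inverse_eq_divide)
      ultimately show ?thesis by simp
    qed
    then show ?thesis by (auto simp: U_def not_less)
  qed
  moreover have add: "(\<lambda>(x, y). (x + y, \<Psi> x + \<Psi> y)) \<in> lborel \<Otimes>\<^sub>M lborel \<rightarrow>\<^sub>M borel"
    unfolding borel_prod[symmetric] by measurable
  ultimately have "emeasure (?\<sigma> \<star> ?\<sigma>) U = 0" by simp
  with supp \<open>open U\<close> \<open>(\<xi>, t) \<in> U\<close> show False
    by (auto simp: measure_support_def)
qed

text \<open>By Fubini, since each vertical line meets the graph in a single point.\<close>

lemma AE_lborel_not_on_graph:
  fixes f :: "'a::euclidean_space \<Rightarrow> real"
  assumes [measurable]: "f \<in> borel_measurable borel"
  shows "AE (x, t) in lborel. t \<noteq> f x"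
proof -
  have "{p \<in> space (lborel \<Otimes>\<^sub>M lborel). snd p \<noteq> f (fst p)} \<in> sets (lborel \<Otimes>\<^sub>M lborel)"
    by measurable
  then have "AE p in lborel \<Otimes>\<^sub>M lborel. snd p \<noteq> f (fst p)"
    by (rule lborel_pair.AE_pair_measure) (simp add: AE_lborel_singleton)
  then show ?thesis unfolding lborel_prod split_def .
qed

text \<open>An index type with one element fewer than \<open>'n\<close>, which turns hyperplanes of \<open>real ^ 'n\<close>
  into a Euclidean space. The guard keeps the type nonempty when \<open>'n\<close> is a singleton.\<close>

typedef ('n::finite) punctured = "{x::'n. CARD('n) \<noteq> 1 \<longrightarrow> x \<noteq> undefined}"
proof (cases "CARD('n) = 1")
  case False
  then have "UNIV \<noteq> {undefined :: 'n}" by (metis card_1_singleton_iff One_nat_def)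
  then show ?thesis by auto
qed auto

instance punctured :: (finite) finite
proof
  have "inj (Rep_punctured :: 'a punctured \<Rightarrow> 'a)" by (simp add: inj_on_def Rep_punctured_inject)
  then show "finite (UNIV :: 'a punctured set)" by (rule finite_imageD[rotated]) simp
qed

lemma CARD_punctured:
  assumes "2 \<le> CARD('n::finite)"
  shows "CARD('n) = Suc CARD('n punctured)"
proof -
  have "CARD('n punctured) = card {x::'n. CARD('n) \<noteq> 1 \<longrightarrow> x \<noteq> undefined}"
    using type_definition.card[OF type_definition_punctured] .
  also have "{x::'n. CARD('n) \<noteq> 1 \<longrightarrow> x \<noteq> undefined} = UNIV - {undefined}"
    using assms by auto
  also have "card (UNIV - {undefined :: 'n}) = CARD('n) - 1"
    by simp
  finally show ?thesis using assms by simp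
qed

theorem theorem1p3:
  fixes \<phi> \<phi>\<^sub>0 \<psi> :: "real ^ 'n \<Rightarrow> real"
    and \<sigma> :: "((real ^ 'n) \<times> real) measure"
  assumes dim: "CARD('n) \<ge> 2"
    and nonneg: "\<And>x. \<phi> x \<ge> 0"
    and diff: "\<And>x. \<phi> differentiable (at x)"
    and C1: "continuous_on UNIV (gradient \<phi>)"
    and strict_convex: "strictly_convex_on UNIV \<phi>"
    and \<phi>\<^sub>0: "\<phi>\<^sub>0 = (\<lambda>y. (norm y)\<^sup>2)"
    and \<psi>: "\<psi> = (\<lambda>y. (norm y)\<^sup>2 + \<phi> y)"
    and \<sigma>: "\<sigma> = projection_measure \<psi>"
  shows "(\<forall>\<xi>. \<forall>\<tau>>0.
            convolution_density \<psi> \<xi> (2 * \<psi> (\<xi> /\<^sub>R 2) + \<tau>)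
              \<le> convolution_density \<phi>\<^sub>0 \<xi> (2 * \<phi>\<^sub>0 (\<xi> /\<^sub>R 2) + \<tau>))
       \<and> (AE (\<xi>, t) in lborel. (\<xi>, t) \<in> measure_support (\<sigma> \<star> \<sigma>) \<longrightarrow>
            (let \<tau> = t - 2 * \<psi> (\<xi> /\<^sub>R 2) in
              convolution_density \<psi> \<xi> (2 * \<psi> (\<xi> /\<^sub>R 2) + \<tau>)
                < convolution_density \<phi>\<^sub>0 \<xi> (2 * \<phi>\<^sub>0 (\<xi> /\<^sub>R 2) + \<tau>)))"
proof -
  \<comment> \<open>Strictness holds at every positive height, which also yields the weak
    inequality. The type \<open>'n punctured\<close> indexes coordinates on hyperplanes.\<close>
  have less: "convolution_density \<psi> \<xi> (2 * \<psi> (\<xi> /\<^sub>R 2) + \<tau>)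
      < convolution_density \<phi>\<^sub>0 \<xi> (2 * \<phi>\<^sub>0 (\<xi> /\<^sub>R 2) + \<tau>)" if "0 < \<tau>" for \<xi> \<tau>
    unfolding \<psi> \<phi>\<^sub>0 using CARD_punctured[OF dim]
    by (intro convolution_density_less[where 'm="'n punctured"] diff C1 strict_convex that) simp
  have cont: "continuous_on UNIV \<psi>"
    unfolding \<psi> using diff
    by (intro continuous_intros) (auto simp: continuous_on_eq_continuous_at differentiable_imp_continuous_within)
  have convex: "convex_on UNIV \<psi>"
    unfolding \<psi> by (intro convex_on_add convex_on_norm_square strictly_convex_on_imp_convex_on strict_convex)
  have [measurable]: "\<psi> \<in> borel_measurable borel"
    using cont by (rule borel_measurable_continuous_onI)
  have "AE (\<xi>, t) in lborel. t \<noteq> 2 * \<psi> (\<xi> /\<^sub>R 2)"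
    by (rule AE_lborel_not_on_graph) measurable
  then have "AE (\<xi>, t) in lborel. (\<xi>, t) \<in> measure_support (\<sigma> \<star> \<sigma>) \<longrightarrow>
            (let \<tau> = t - 2 * \<psi> (\<xi> /\<^sub>R 2) in
              convolution_density \<psi> \<xi> (2 * \<psi> (\<xi> /\<^sub>R 2) + \<tau>)
                < convolution_density \<phi>\<^sub>0 \<xi> (2 * \<phi>\<^sub>0 (\<xi> /\<^sub>R 2) + \<tau>))"
  proof eventually_elim
    case (elim p)
    obtain \<xi> t where p: "p = (\<xi>, t)" by (cases p)
    \<comment> \<open>A point of the support lies on or above the graph, and \<open>elim\<close>
      excludes the graph itself.\<close>
    have "0 < t - 2 * \<psi> (\<xi> /\<^sub>R 2)" if "(\<xi>, t) \<in> measure_support (\<sigma> \<star> \<sigma>)"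
      using measure_support_projection_convolution[OF cont convex] that elim
      unfolding \<sigma> p by fastforce
    then show ?case using less unfolding p Let_def by blast
  qed
  with less show ?thesis by (auto intro: less_imp_le)
qed

end
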